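(* For any uniquely ergodic minimal subshift $X\in\overline{\mathbf{TT}'}$, the orbit equivalence class of $X$ in $\overline{\mathbf{TT}'}$ (the set of $Y\in\overline{\mathbf{TT}'}$ orbit equivalent to $X$) is meager in $\overline{\mathbf{TT}'}$. Consequently, no orbit equivalence class is generic (residual) in $\overline{\mathbf{TT}'}$.
   Context: A subshift is a nonempty compact set $X\subset\mathbb{Z}^{\mathbb{Z}}$ (product topology, $\mathbb{Z}$ discrete) with $\sigma(X)=X$, where $(\sigma x)_i=x_{i+1}$; it is automatically over a finite alphabet. $L_n(X)$ is the set of $n$-letter words occurring in points of $X$. $\mathbf{S}$ is the set of all subshifts with the metric $d(X,Y)=2^{-\inf\{n:L_n(X)\ne L_n(Y)\}}$ ($d(X,X)=0$). $X$ is totally transitive if for every $n\ge1$ there is $x\in X$ with $\{\sigma^{in}x\}_{i\in\mathbb{Z}}$ dense in $X$; $\mathbf{TT}'$ is the set of infinite totally transitive subshifts and $\overline{\mathbf{TT}'}$ is its closure in $\mathbf{S}$. Systems $(X,T)$ and $(Y,S)$ are orbit equivalent if there is a homeomorphism $\phi:X\to Y$ with $\{\phi(T^nx)\}_{n\in\mathbb{Z}}=\{S^n\phi(x)\}_{n\in\mathbb{Z}}$ for all $x\in X$. Residual means containing a dense $G_\delta$. *)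

theory Defs
  imports "HOL-Probability.Probability"
begin

text \<open>
  Points of the full shift are functions of type \<^typ>\<open>int \<Rightarrow> int\<close>. The library topology on this type
  is the product topology over the discrete topology of \<^typ>\<open>int\<close>.
\<close>

definition left_shift :: "(int \<Rightarrow> int) \<Rightarrow> (int \<Rightarrow> int)" where
  "left_shift x = (\<lambda>i. x (i + 1))"

text \<open>The integer powers of \<^const>\<open>left_shift\<close>, negative ones included.\<close>

definition shift_pow :: "int \<Rightarrow> (int \<Rightarrow> int) \<Rightarrow> (int \<Rightarrow> int)" where
  "shift_pow k x = (\<lambda>i. x (i + k))"

lemma shift_pow_0 [simp]: "shift_pow 0 x = x"
  by (simp add: shift_pow_def)

lemma shift_pow_1: "shift_pow 1 = left_shift"
  by (simp add: shift_pow_def left_shift_def fun_eq_iff)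

lemma shift_pow_add: "shift_pow (j + k) x = shift_pow j (shift_pow k x)"
  by (simp add: shift_pow_def add.assoc)

definition subshift :: "(int \<Rightarrow> int) set \<Rightarrow> bool" where
  "subshift X \<longleftrightarrow> X \<noteq> {} \<and> compact X \<and> left_shift ` X = X"

definition language :: "nat \<Rightarrow> (int \<Rightarrow> int) set \<Rightarrow> int list set" where
  "language n X = {map (\<lambda>j. x (i + int j)) [0..<n] | x i. x \<in> X}"

text \<open>
  Words are compared from length 0 on; this is harmless, as \<^term>\<open>language 0 X\<close> consists of the
  empty word for every nonempty \<^term>\<open>X\<close>.
\<close>

definition subshift_dist :: "(int \<Rightarrow> int) set \<Rightarrow> (int \<Rightarrow> int) set \<Rightarrow> real" where
  "subshift_dist X Y = (if X = Y then 0 else 1 / 2 ^ Inf {n. language n X \<noteq> language n Y})"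

lemma subshift_shift_pow:
  assumes "subshift X" and "x \<in> X"
  shows "shift_pow k x \<in> X"
proof -
  have im: "left_shift ` X = X"
    using assms(1) by (simp add: subshift_def)
  have fwd: "shift_pow (int n) y \<in> X" if "y \<in> X" for n y
    using that
  proof (induction n)
    case (Suc n)
    have "shift_pow (int (Suc n)) y = left_shift (shift_pow (int n) y)"
      using shift_pow_add[of 1 "int n" y] by (simp add: shift_pow_1)
    then show ?case
      using Suc im by auto
  qed simp
  have bwd: "shift_pow (- int n) y \<in> X" if "y \<in> X" for n y
    using that
  proof (induction n)
    case (Suc n)
    obtain z where z: "z \<in> X" "left_shift z = shift_pow (- int n) y"
      using Suc im by (metis imageE)
    have "shift_pow (- int (Suc n)) y = shift_pow (-1) (shift_pow (- int n) y)"
      using shift_pow_add[of "-1" "- int n" y] by simp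
    also have "\<dots> = z"
      unfolding z(2)[symmetric] by (simp add: shift_pow_def left_shift_def)
    finally show ?case
      using z by simp
  qed simp
  show ?thesis
    using fwd[OF assms(2), of "nat k"] bwd[OF assms(2), of "nat (-k)"] by (cases "k \<ge> 0") auto
qed

lemma subshift_subset_if_language_eq:
  assumes X: "subshift X" and Y: "subshift Y" and eq: "\<And>n. language n X = language n Y"
  shows "X \<subseteq> Y"
proof (rule ccontr)
  assume "\<not> X \<subseteq> Y"
  then obtain x where x: "x \<in> X" "x \<notin> Y" by blast
  have "Hausdorff_space (euclidean :: int topology)"
    unfolding Hausdorff_space_def disjnt_def using hausdorff by simp blast
  then have "Hausdorff_space (euclidean :: (int \<Rightarrow> int) topology)"
    unfolding euclidean_product_topology[symmetric] Hausdorff_space_product_topology by simp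
  then have "closed Y"
    using Y compactin_imp_closedin[of euclidean Y] by (simp add: subshift_def)
  then have "openin (product_topology (\<lambda>_::int. euclidean :: int topology) UNIV) (- Y)"
    by (simp add: euclidean_product_topology open_Compl)
  then obtain U where U: "x \<in> (\<Pi>\<^sub>E i\<in>UNIV. U i)" "finite {i. U i \<noteq> UNIV}" "(\<Pi>\<^sub>E i\<in>UNIV. U i) \<subseteq> - Y"
    using product_topology_open_contains_basis[of "\<lambda>_. euclidean" UNIV "- Y" x] x(2) by auto
  obtain N :: nat where N: "\<And>i. U i \<noteq> UNIV \<Longrightarrow> \<bar>i\<bar> \<le> int N"
  proof -
    have "\<exists>k. \<forall>i\<in>{i. U i \<noteq> UNIV}. nat \<bar>i\<bar> \<le> k"
      using finite_nat_set_iff_bounded_le[of "(\<lambda>i. nat \<bar>i\<bar>) ` {i. U i \<noteq> UNIV}"] U(2) by auto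
    then obtain k where "\<And>i. U i \<noteq> UNIV \<Longrightarrow> nat \<bar>i\<bar> \<le> k" by blast
    then show ?thesis
      by (intro that[of k]) force
  qed
  let ?n = "2 * N + 1"
  have "map (\<lambda>j. x (- int N + int j)) [0..<?n] \<in> language ?n X"
    unfolding language_def using x(1) by blast
  then have "map (\<lambda>j. x (- int N + int j)) [0..<?n] \<in> language ?n Y"
    using eq by simp
  then obtain y i where y: "y \<in> Y"
    and m: "map (\<lambda>j. x (- int N + int j)) [0..<?n] = map (\<lambda>j. y (i + int j)) [0..<?n]"
    unfolding language_def by blast
  have agree: "x (- int N + int j) = y (i + int j)" if "j < ?n" for j
    using arg_cong[OF m, of "\<lambda>w. w ! j"] that by (simp del: upt_Suc)
  let ?z = "shift_pow (i + int N) y"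
  have "?z k \<in> U k" for k
  proof (cases "U k = UNIV")
    case False
    then have k: "\<bar>k\<bar> \<le> int N" using N by blast
    then have "0 \<le> k + int N" "nat (k + int N) < ?n"
      by linarith+
    then have "x k = y (i + (k + int N))"
      using agree[of "nat (k + int N)"] by simp
    then have "?z k = x k"
      by (simp add: shift_pow_def algebra_simps)
    then show ?thesis using U(1) by auto
  qed simp
  then have "?z \<in> - Y"
    using U(3) by auto
  moreover have "?z \<in> Y"
    using subshift_shift_pow[OF Y y] .
  ultimately show False by simp
qed

interpretation subshifts: Metric_space "Collect subshift" subshift_dist
proof
  fix X Y Z :: "(int \<Rightarrow> int) set"
  show "0 \<le> subshift_dist X Y"
    by (simp add: subshift_dist_def)
  show "subshift_dist X Y = subshift_dist Y X"
    by (auto simp: subshift_dist_def intro!: arg_cong[where f = "\<lambda>n. 2 ^ n"] arg_cong[where f = Inf])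
  show "subshift_dist X Y = 0 \<longleftrightarrow> X = Y"
    by (simp add: subshift_dist_def)
  assume S: "X \<in> Collect subshift" "Y \<in> Collect subshift" "Z \<in> Collect subshift"
  have le: "1 / 2 ^ n \<le> subshift_dist A B" if "language n A \<noteq> language n B" for A B n
  proof -
    have "Inf {n. language n A \<noteq> language n B} \<le> n"
      using that by (intro cInf_lower) auto
    then have "(1::real) / 2 ^ n \<le> 1 / 2 ^ Inf {n. language n A \<noteq> language n B}"
      by (intro divide_left_mono power_increasing) auto
    then show ?thesis
      using that by (auto simp: subshift_dist_def)
  qed
  have nn: "0 \<le> subshift_dist A B" for A B
    by (simp add: subshift_dist_def)
  show "subshift_dist X Z \<le> subshift_dist X Y + subshift_dist Y Z"
  proof (cases "X = Z")
    case True
    then show ?thesis using nn[of X Y] nn[of Y Z] by (simp add: subshift_dist_def)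
  next
    case False
    then have "{n. language n X \<noteq> language n Z} \<noteq> {}"
      using subshift_subset_if_language_eq[of X Z] subshift_subset_if_language_eq[of Z X] S
      by auto
    then have "Inf {n. language n X \<noteq> language n Z} \<in> {n. language n X \<noteq> language n Z}"
      by (rule Inf_nat_def1)
    moreover define n where "n = Inf {n. language n X \<noteq> language n Z}"
    ultimately have "language n X \<noteq> language n Y \<or> language n Y \<noteq> language n Z"
      by auto
    moreover have "subshift_dist X Z = 1 / 2 ^ n"
      using False by (simp add: subshift_dist_def n_def)
    ultimately show ?thesis
      using le[of n X Y] le[of n Y Z] nn[of X Y] nn[of Y Z] by linarith
  qed
qed

definition totally_transitive :: "(int \<Rightarrow> int) set \<Rightarrow> bool" where
  "totally_transitive X \<longleftrightarrow>
    (\<forall>n::nat. n \<ge> 1 \<longrightarrow> (\<exists>x\<in>X. X \<subseteq> closure {shift_pow (i * int n) x | i. True}))"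

definition infinite_tt :: "(int \<Rightarrow> int) set set" where
  "infinite_tt = {X. subshift X \<and> infinite X \<and> totally_transitive X}"

definition infinite_tt_closure :: "(int \<Rightarrow> int) set set" where
  "infinite_tt_closure = subshifts.mtopology closure_of infinite_tt"

definition infinite_tt_closure_topology :: "(int \<Rightarrow> int) set topology" where
  "infinite_tt_closure_topology = subtopology subshifts.mtopology infinite_tt_closure"

definition minimal_subshift :: "(int \<Rightarrow> int) set \<Rightarrow> bool" where
  "minimal_subshift X \<longleftrightarrow> subshift X \<and> (\<forall>Y. subshift Y \<and> Y \<subseteq> X \<longrightarrow> Y = X)"

definition invariant_prob :: "(int \<Rightarrow> int) set \<Rightarrow> (int \<Rightarrow> int) measure \<Rightarrow> bool" where
  "invariant_prob X M \<longleftrightarrow>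
    sets M = sets (restrict_space borel X) \<and> prob_space M \<and>
    (\<forall>A\<in>sets M. emeasure M (left_shift -` A \<inter> space M) = emeasure M A)"

definition uniquely_ergodic :: "(int \<Rightarrow> int) set \<Rightarrow> bool" where
  "uniquely_ergodic X \<longleftrightarrow> (\<exists>!M. invariant_prob X M)"

definition orbit_equivalent :: "(int \<Rightarrow> int) set \<Rightarrow> (int \<Rightarrow> int) set \<Rightarrow> bool" where
  "orbit_equivalent X Y \<longleftrightarrow>
    (\<exists>\<phi> \<psi>. homeomorphism X Y \<phi> \<psi> \<and>
      (\<forall>x\<in>X. {\<phi> (shift_pow n x) | n. True} = {shift_pow n (\<phi> x) | n. True}))"

definition orbit_equivalence_class :: "(int \<Rightarrow> int) set \<Rightarrow> (int \<Rightarrow> int) set set" where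
  "orbit_equivalence_class X = {Y \<in> infinite_tt_closure. orbit_equivalent X Y}"

definition nowhere_dense_in :: "'a topology \<Rightarrow> 'a set \<Rightarrow> bool" where
  "nowhere_dense_in T A \<longleftrightarrow> A \<subseteq> topspace T \<and> T interior_of (T closure_of A) = {}"

definition meager_in :: "'a topology \<Rightarrow> 'a set \<Rightarrow> bool" where
  "meager_in T A \<longleftrightarrow> (\<exists>\<N>. countable \<N> \<and> (\<forall>N\<in>\<N>. nowhere_dense_in T N) \<and> A = \<Union>\<N>)"

definition residual_in :: "'a topology \<Rightarrow> 'a set \<Rightarrow> bool" where
  "residual_in T A \<longleftrightarrow>
    A \<subseteq> topspace T \<and> (\<exists>G\<subseteq>A. gdelta_in T G \<and> T closure_of G = topspace T)"

end

theory Submission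
  imports Defs "HOL-Library.Sublist" "HOL-Number_Theory.Cong"
begin

text \<open>
  Fix an invariant probability measure on \<open>X\<close>. An orbit equivalence from \<open>X\<close> to \<open>Y\<close> carries it to an
  invariant probability measure on \<open>Y\<close> (orbit_equivalence_transports_invariant_prob), and the
  cylinder of a letter of \<open>Y\<close> corresponds to a clopen subset of \<open>X\<close>. As \<open>X\<close> has only countably many clopen
  subsets, there is a countable set of numbers, depending on \<open>X\<close> only, such that every \<open>Y\<close> in the class has
  an invariant measure that takes its letter measures in this set
  (orbit_equivalent_letter_measures).
  
  It therefore suffices that for each letter \<open>a\<close> and each number \<open>s\<close> the subshifts that contain \<open>a\<close> and have
  an invariant measure giving it mass \<open>s\<close> are nowhere dense (nowhere_dense_letter_measure). The measure of \<open>a\<close>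
  lies between the smallest and the largest frequency of \<open>a\<close> in the words of any fixed length, so the
  task is to perturb an infinite totally transitive subshift, keeping its words of length \<open>n\<close>, so that
  the frequency of \<open>a\<close> in all long words stays away from \<open>s\<close>
  (letter_frequency_perturbation). Total transitivity makes the Rauzy graph of the words of length \<open>n\<close> strongly
  connected and aperiodic, so that it has closed walks of two consecutive lengths through all vertices
  (return_words_of_consecutive_lengths). The letter has different frequencies along these walks, as consecutive lengths are coprime, so one of them has
  a frequency different from \<open>s\<close>. Concatenating almost only this walk, with rare insertions of the two walks to
  keep the lengths of the blocks consecutive, generates the perturbed subshift.
  
  An invariant measure always exists by the argument of Krylov and Bogoliubov (invariant_prob_exists), so
  every orbit equivalence class is meager. The space of subshifts is complete (mcomplete_subshifts),
  hence by the theorem of Baire a meager set is not residual in the closed subspace.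
\<close>

section \<open>Words, languages and cylinders\<close>

definition word :: "(int \<Rightarrow> int) \<Rightarrow> int \<Rightarrow> nat \<Rightarrow> int list" where
  "word x i n = map (\<lambda>j. x (i + int j)) [0..<n]"

lemma length_word [simp]: "length (word x i n) = n"
  by (simp add: word_def)

lemma nth_word [simp]: "j < n \<Longrightarrow> word x i n ! j = x (i + int j)"
  by (simp add: word_def)

lemma word_eq_iff: "word x i n = word y k n \<longleftrightarrow> (\<forall>j<n. x (i + int j) = y (k + int j))"
  by (auto simp: list_eq_iff_nth_eq)

lemma word_add: "word x i (m + n) = word x i m @ word x (i + int m) n"
  by (rule nth_equalityI) (auto simp: nth_append)

lemma word_1: "word x i (Suc 0) = [x i]"
  by (simp add: word_def)

lemma word_shift_pow [simp]: "word (shift_pow k x) i n = word x (i + k) n"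
  by (simp add: word_def shift_pow_def algebra_simps)

lemma take_word: "m \<le> n \<Longrightarrow> take m (word x i n) = word x i m"
  by (rule nth_equalityI) auto

lemma drop_word: "drop m (word x i n) = word x (i + int m) (n - m)"
  by (rule nth_equalityI) (auto simp: algebra_simps)

lemma sublist_word:
  assumes "i' \<le> i" "i + int n \<le> i' + int n'"
  shows "sublist (word x i n) (word x i' n')"
proof -
  have "word x i n = take n (drop (nat (i - i')) (word x i' n'))"
    using assms by (simp add: drop_word take_word)
  then show ?thesis
    by (metis sublist_def append_take_drop_id)
qed

lemma sublist_wordD:
  assumes "sublist w (word x i n)"
  obtains k where "i \<le> k" "k + int (length w) \<le> i + int n" "w = word x k (length w)"
proof -
  obtain l r where lr: "word x i n = l @ w @ r"
    using assms by (auto simp: sublist_def)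
  then have n: "n = length l + length w + length r"
    by (metis length_word length_append add.assoc)
  have "w = take (length w) (drop (length l) (word x i n))"
    using lr by simp
  also have "\<dots> = word x (i + int (length l)) (length w)"
    by (simp add: drop_word take_word n)
  finally show ?thesis
    by (intro that[of "i + int (length l)"]) (auto simp: n)
qed

lemma language_eq: "language n X = {word x i n | x i. x \<in> X}"
  by (simp add: language_def word_def)

lemma word_in_language: "x \<in> X \<Longrightarrow> word x i n \<in> language n X"
  by (auto simp: language_eq)

lemma length_language: "w \<in> language n X \<Longrightarrow> length w = n"
  by (auto simp: language_eq)

lemma language_take: "m \<le> n \<Longrightarrow> language m X = take m ` language n X"
  unfolding language_eq by (force simp: take_word image_iff)

lemma language_eq_mono: "language n X = language n Y \<Longrightarrow> m \<le> n \<Longrightarrow> language m X = language m Y"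
  by (simp add: language_take)

text \<open>
  Balls in the space of subshifts are given by languages: this turns every topological question
  below into a question about words of one fixed length.
\<close>

lemma subshift_dist_less_iff:
  assumes "subshift X" "subshift Y"
  shows "subshift_dist X Y < 1 / 2 ^ n \<longleftrightarrow> language n X = language n Y"
proof (cases "X = Y")
  case True
  then show ?thesis by (simp add: subshift_dist_def)
next
  case False
  define D where "D = {n. language n X \<noteq> language n Y}"
  have "D \<noteq> {}"
    using subshift_subset_if_language_eq[of X Y] subshift_subset_if_language_eq[of Y X] assms False
    by (auto simp: D_def)
  then have "Inf D \<in> D" by (rule Inf_nat_def1)
  have "n < Inf D \<longleftrightarrow> n \<notin> D"
  proof
    assume "n < Inf D" then show "n \<notin> D"
      using cInf_lower[of n D] by auto
  next
    assume "n \<notin> D" show "n < Inf D"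
      using \<open>n \<notin> D\<close> \<open>Inf D \<in> D\<close> language_eq_mono[of n X Y "Inf D"] by (force simp: D_def)
  qed
  moreover have "subshift_dist X Y < 1 / 2 ^ n \<longleftrightarrow> n < Inf D"
    using False by (simp add: subshift_dist_def D_def[symmetric] field_simps)
  ultimately show ?thesis by (simp add: D_def)
qed

lemma open_coordinate: "open {y :: int \<Rightarrow> int. y i \<in> A}"
proof -
  have "open ((\<lambda>y :: int \<Rightarrow> int. y i) -` A)"
    by (intro open_vimage Topological_Spaces.open_discrete continuous_on_product_coordinates)
  then show ?thesis by (simp add: vimage_def)
qed

lemma open_cylinder: "open {y. word y i n = w}"
proof (cases "length w = n")
  case True
  have "{y. word y i n = w} = (\<Inter>j\<in>{..<n}. {y. y (i + int j) \<in> {w ! j}})"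
    using True by (auto simp: list_eq_iff_nth_eq)
  then show ?thesis
    by (simp only:) (intro open_INT ballI open_coordinate finite_lessThan)
qed (auto intro!: open_subopen[THEN iffD2])

lemma open_word: "open {y. word y i n \<in> A}"
proof -
  have "{y. word y i n \<in> A} = (\<Union>w\<in>A. {y. word y i n = w})" by auto
  then show ?thesis by (auto intro: open_cylinder)
qed

lemma closed_word: "closed {y. word y i n \<in> A}"
proof -
  have "- {y. word y i n \<in> A} = {y. word y i n \<in> - A}" by auto
  then show ?thesis unfolding closed_def by (simp only: open_word)
qed

text \<open>
  Central cylinders form a neighbourhood base of each point, because a basic open set of the product
  topology restricts only finitely many coordinates.
\<close>

lemma open_contains_cylinder:
  assumes "open G" "z \<in> G"
  obtains k :: nat where "\<And>y. word y (- int k) (2 * k + 1) = word z (- int k) (2 * k + 1) \<Longrightarrow> y \<in> G"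
proof -
  have "openin (product_topology (\<lambda>_::int. euclidean :: int topology) UNIV) G"
    using assms by (simp add: euclidean_product_topology)
  then obtain U where U: "z \<in> (\<Pi>\<^sub>E i\<in>UNIV. U i)" "finite {i. U i \<noteq> UNIV}" "(\<Pi>\<^sub>E i\<in>UNIV. U i) \<subseteq> G"
    using product_topology_open_contains_basis[of "\<lambda>_. euclidean" UNIV G z] assms(2) by auto
  obtain b :: nat where b: "\<And>i. U i \<noteq> UNIV \<Longrightarrow> \<bar>i\<bar> \<le> int b"
  proof -
    have "finite ((\<lambda>i. nat \<bar>i\<bar>) ` {i. U i \<noteq> UNIV})" using U(2) by simp
    then obtain k where "\<And>i. U i \<noteq> UNIV \<Longrightarrow> nat \<bar>i\<bar> \<le> k"
      unfolding finite_nat_set_iff_bounded_le by blast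
    then show ?thesis by (intro that[of k]) force
  qed
  show ?thesis
  proof (rule that[of b])
    fix y assume y: "word y (- int b) (2 * b + 1) = word z (- int b) (2 * b + 1)"
    have "y i \<in> U i" for i
    proof (cases "U i = UNIV")
      case False
      then have "\<bar>i\<bar> \<le> int b" using b by blast
      then have "nat (i + int b) < 2 * b + 1" "int (nat (i + int b)) = i + int b" by linarith+
      then have "y i = z i"
        using y[unfolded word_eq_iff, rule_format, of "nat (i + int b)"] by simp
      then show ?thesis using U(1) by auto
    qed simp
    then show "y \<in> G" using U(3) by auto
  qed
qed

lemma compact_sequences_over:
  assumes "finite A" shows "compact {x :: int \<Rightarrow> int. \<forall>i. x i \<in> A}"
proof -
  have "compactin (product_topology (\<lambda>_::int. euclidean :: int topology) UNIV) (\<Pi>\<^sub>E i\<in>UNIV. A)"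
    using assms by (simp add: compactin_PiE finite_imp_compact)
  moreover have "(\<Pi>\<^sub>E i\<in>UNIV. A) = {x :: int \<Rightarrow> int. \<forall>i. x i \<in> A}" by auto
  ultimately show ?thesis by (simp add: euclidean_product_topology)
qed

definition sequences_with :: "int list set \<Rightarrow> (int \<Rightarrow> int) set" where
  "sequences_with \<Lambda> = {x. \<forall>i n. word x i n \<in> \<Lambda>}"

lemma left_shift_image_eq:
  assumes "\<And>x k. x \<in> X \<Longrightarrow> shift_pow k x \<in> X"
  shows "left_shift ` X = X"
proof
  show "left_shift ` X \<subseteq> X" using assms by (auto simp: shift_pow_1[symmetric])
  show "X \<subseteq> left_shift ` X"
  proof
    fix x assume "x \<in> X"
    have "left_shift (shift_pow (-1) x) = x" by (simp add: left_shift_def shift_pow_def)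
    then show "x \<in> left_shift ` X" using assms[OF \<open>x \<in> X\<close>] by (metis imageI)
  qed
qed

text \<open>
  Subshifts are built from their languages: a set of admissible words gives a closed shift invariant
  set of sequences, and finitely many admissible letters make it compact. What remains to be checked
  in each case is that there are enough sequences, since an admissible word may have no extension.
\<close>

lemma subshift_sequences_with:
  assumes fin: "finite {c. [c] \<in> \<Lambda>}" and ne: "sequences_with \<Lambda> \<noteq> {}"
  shows "subshift (sequences_with \<Lambda>)"
proof -
  have cl: "closed (sequences_with \<Lambda>)"
    unfolding sequences_with_def by (intro closed_Collect_all closed_word)
  have "sequences_with \<Lambda> \<subseteq> {x. \<forall>i. x i \<in> {c. [c] \<in> \<Lambda>}}"
    by (auto simp: sequences_with_def word_1[symmetric])
  then have "compact (sequences_with \<Lambda>)"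
    using compact_Int_closed[OF compact_sequences_over[OF fin] cl] by (simp add: inf.absorb2)
  moreover have "left_shift ` sequences_with \<Lambda> = sequences_with \<Lambda>"
    by (rule left_shift_image_eq) (auto simp: sequences_with_def)
  ultimately show ?thesis using ne by (simp add: subshift_def)
qed

text \<open>
  The cylinders of the words of a fixed length are an open cover of the compact set; as they are
  pairwise disjoint, a finite subcover must already contain all of them.
\<close>

lemma finite_language:
  assumes "subshift X" shows "finite (language n X)"
proof -
  have c: "compact X" using assms by (simp add: subshift_def)
  have im: "language n X = (\<lambda>x. word x 0 n) ` X"
  proof -
    have "word x i n = word (shift_pow i x) 0 n" for x i by simp
    then show ?thesis
      using subshift_shift_pow[OF assms] unfolding language_eq by blast
  qed
  obtain F where F: "F \<subseteq> language n X" "finite F" "X \<subseteq> (\<Union>w\<in>F. {y. word y 0 n = w})"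
  proof (rule compactE_image[OF c, of "language n X" "\<lambda>w. {y. word y 0 n = w}"])
    show "X \<subseteq> (\<Union>w\<in>language n X. {y. word y 0 n = w})"
      by (auto simp: word_in_language)
  qed (auto simp: open_cylinder)
  then have "language n X \<subseteq> F" unfolding im by auto
  then show ?thesis using F(2) finite_subset by blast
qed

text \<open>
  Total transitivity in terms of words: in a point whose orbit under the \<open>m\<close>-th power is dense, each
  word occurs at positions of every residue class modulo \<open>m\<close>, because shifting the target cylinder by
  \<open>r\<close> coordinates gives again a nonempty cylinder. The occurrences may lie to either side of the
  origin.
\<close>

lemma totally_transitive_occurrences:
  assumes X: "subshift X" and tt: "totally_transitive X" and m: "m \<ge> 1"
  obtains x where "x \<in> X"
    "\<And>w n r. w \<in> language n X \<Longrightarrow> \<exists>i. [i = r] (mod int m) \<and> word x i n = w"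
proof -
  obtain x where x: "x \<in> X" "X \<subseteq> closure {shift_pow (i * int m) x | i. True}"
    using tt m by (auto simp: totally_transitive_def)
  show ?thesis
  proof (rule that[OF x(1)])
    fix w n r assume "w \<in> language n X"
    then obtain z k where z: "z \<in> X" "w = word z k n" by (auto simp: language_eq)
    let ?z = "shift_pow (k - r) z"
    have "?z \<in> closure {shift_pow (i * int m) x | i. True}"
      using subshift_shift_pow[OF X z(1)] x(2) by blast
    moreover have "open {y. word y r n = w}" "?z \<in> {y. word y r n = w}"
      by (auto simp: open_cylinder z(2))
    ultimately obtain y where "y \<in> {shift_pow (i * int m) x | i. True}" "word y r n = w"
      using closure_iff_nhds_not_empty by blast
    then obtain i where "word x (r + i * int m) n = w" by auto
    moreover have "[r + i * int m = r] (mod int m)" by (simp add: cong_def)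
    ultimately show "\<exists>i. [i = r] (mod int m) \<and> word x i n = w" by blast
  qed
qed

lemma totally_transitiveI:
  assumes x: "x \<in> X"
    and occ: "\<And>w m n r. w \<in> language n X \<Longrightarrow> m \<ge> 1 \<Longrightarrow> \<exists>i. [i = r] (mod int m) \<and> word x i n = w"
  shows "totally_transitive X"
  unfolding totally_transitive_def
proof (intro allI impI bexI[OF _ x] subsetI)
  fix m :: nat and z assume m: "1 \<le> m" and z: "z \<in> X"
  show "z \<in> closure {shift_pow (i * int m) x | i. True}"
    unfolding closure_iff_nhds_not_empty
  proof (intro allI impI)
    fix G V assume G: "V \<subseteq> G" "open V" "z \<in> V"
    obtain k where k: "\<And>y. word y (- int k) (2 * k + 1) = word z (- int k) (2 * k + 1) \<Longrightarrow> y \<in> V"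
      using open_contains_cylinder[OF G(2,3)] by blast
    obtain i where i: "[i = - int k] (mod int m)" "word x i (2 * k + 1) = word z (- int k) (2 * k + 1)"
      using occ[OF word_in_language[OF z] m] by blast
    then obtain l where "i = - int k + l * int m"
      by (metis cong_iff_lin cong_sym mult.commute)
    then have "shift_pow (l * int m) x \<in> V"
      by (intro k) (use i(2) in simp)
    then show "{shift_pow (i * int m) x | i. True} \<inter> G \<noteq> {}"
      using G by blast
  qed
qed

text \<open>
  A finite subshift consists of periodic points whose periods divide a common number \<open>m\<close>, here
  \<open>(card X)!\<close>. In such a point two different letters cannot occur in the same residue class
  modulo \<open>m\<close>.
\<close>

lemma infinite_if_totally_transitive:
  assumes X: "subshift X" and tt: "totally_transitive X"
    and ac: "[a] \<in> language 1 X" "[c] \<in> language 1 X" "a \<noteq> c"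
  shows "infinite X"
proof
  assume fin: "finite X"
  define m :: nat where "m = fact (card X)"
  have "m \<ge> 1" by (simp add: m_def)
  then obtain x where x: "x \<in> X"
    and occ: "\<And>w n r. w \<in> language n X \<Longrightarrow> \<exists>i. [i = r] (mod int m) \<and> word x i n = w"
    using totally_transitive_occurrences[OF X tt] by blast
  have "\<not> inj_on (\<lambda>k. shift_pow (int k) x) {..card X}"
  proof
    assume "inj_on (\<lambda>k. shift_pow (int k) x) {..card X}"
    then have "card {..card X} \<le> card X"
      by (rule card_inj_on_le[OF _ _ fin]) (use subshift_shift_pow[OF X x] in auto)
    then show False by simp
  qed
  then obtain k l where kl: "k < l" "l \<le> card X" "shift_pow (int k) x = shift_pow (int l) x"
    unfolding inj_on_def by (metis atMost_iff linorder_neqE_nat)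
  define d where "d = l - k"
  have per: "x (i + int d) = x i" for i
    using fun_cong[OF kl(3), of "i - int k"] kl(1) by (simp add: shift_pow_def d_def algebra_simps)
  have per': "x (i + int d * int q) = x i" for i and q :: nat
  proof (induction q)
    case (Suc q) then show ?case using per[of "i + int d * int q"] by (simp add: algebra_simps)
  qed simp
  have per'': "x (i + int d * q) = x i" for i and q :: int
    using per'[of i "nat q"] per'[of "i + int d * q" "nat (- q)"] by (cases "q \<ge> 0") (auto simp: algebra_simps)
  have "d dvd m" unfolding m_def by (rule dvd_fact) (use kl in \<open>auto simp: d_def\<close>)
  obtain i where i: "[i = 0] (mod int m)" "word x i 1 = [a]" using occ[OF ac(1)] by blast
  obtain j where j: "[j = 0] (mod int m)" "word x j 1 = [c]" using occ[OF ac(2)] by blast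
  have "[i = j] (mod int d)"
    using i(1) j(1) \<open>d dvd m\<close> by (meson cong_dvd_modulus cong_sym cong_trans int_dvd_int_iff)
  then obtain q where "j = i + int d * q" by (metis cong_iff_lin)
  then have "x i = x j" using per'' by simp
  then show False using i(2) j(2) ac(3) by (simp add: word_1)
qed

section \<open>Return words in a totally transitive subshift\<close>

text \<open>
  An arithmetical form of aperiodicity. The least positive difference \<open>d\<close> of two elements must be 1:
  otherwise some element \<open>t\<close> is not divisible by \<open>d\<close>, and combining \<open>t\<close> with multiples of two elements
  at distance \<open>d\<close> gives the smaller difference \<open>t mod d\<close>.
\<close>

lemma additive_semigroup_consecutive:
  fixes S :: "nat set"
  assumes zero: "0 \<in> S" and add: "\<And>s t. s \<in> S \<Longrightarrow> t \<in> S \<Longrightarrow> s + t \<in> S"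
    and nd: "\<And>d. d \<ge> 2 \<Longrightarrow> \<exists>t\<in>S. \<not> d dvd t"
  obtains k where "k \<in> S" "Suc k \<in> S"
proof -
  have mult: "q * s \<in> S" if "s \<in> S" for q s
    by (induction q) (auto simp: zero add that)
  define D where "D = {d. d > 0 \<and> (\<exists>s\<in>S. s + d \<in> S)}"
  obtain t where "t \<in> S" "\<not> 2 dvd t" using nd[of 2] by auto
  then have "t \<in> D" using zero by (auto simp: D_def intro!: Nat.gr0I bexI[of _ 0])
  define d where "d = (LEAST d. d \<in> D)"
  have "d \<in> D" unfolding d_def by (rule LeastI) fact
  have least: "d \<le> e" if "e \<in> D" for e unfolding d_def using that by (rule Least_le)
  obtain s where s: "d > 0" "s \<in> S" "s + d \<in> S" using \<open>d \<in> D\<close> by (auto simp: D_def)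
  have "d < 2"
  proof (rule ccontr)
    assume "\<not> d < 2"
    then obtain t where t: "t \<in> S" "\<not> d dvd t" using nd[of d] by auto
    have "t + t div d * s = t div d * (s + d) + t mod d"
      by (simp add: algebra_simps)
    moreover have "t + t div d * s \<in> S" "t div d * (s + d) \<in> S" using s t by (auto intro: add mult)
    ultimately have "t mod d \<in> D"
      using t(2) by (auto simp: D_def mod_greater_zero_iff_not_dvd intro!: bexI[of _ "t div d * (s + d)"])
    then show False using least[of "t mod d"] mod_less_divisor[OF s(1), of t] by simp
  qed
  then have "d = 1" using s by simp
  then show ?thesis using s that[of s] by simp
qed

text \<open>
  These are the labels of closed walks at the vertex \<open>b\<close> of the Rauzy graph whose paths are the words
  with all factors of length \<open>n\<close> in \<open>L\<close>; the label \<open>u\<close> omits the initial \<open>b\<close>.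
\<close>

definition return_words :: "nat \<Rightarrow> int list set \<Rightarrow> int list \<Rightarrow> int list set" where
  "return_words n L b = {u. suffix b (b @ u) \<and> (\<forall>w. sublist w (b @ u) \<longrightarrow> length w = n \<longrightarrow> w \<in> L)}"

text \<open>
  Closed walks at the same vertex can be concatenated: since \<open>b\<close> is at least \<open>n\<close> long, a factor of
  length \<open>n\<close> that crosses the seam sees at most the copy of \<open>b\<close> in front of it.
\<close>

lemma return_words_append:
  assumes "u \<in> return_words n L b" "v \<in> return_words n L b" and n: "n \<le> length b"
  shows "u @ v \<in> return_words n L b"
proof -
  have u: "suffix b (b @ u)" "\<And>w. sublist w (b @ u) \<Longrightarrow> length w = n \<Longrightarrow> w \<in> L"
   and v: "suffix b (b @ v)" "\<And>w. sublist w (b @ v) \<Longrightarrow> length w = n \<Longrightarrow> w \<in> L"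
    using assms by (auto simp: return_words_def)
  obtain c where c: "b @ u = c @ b" using u(1) by (auto simp: suffix_def)
  have eq: "b @ u @ v = c @ b @ v" using c by (metis append.assoc)
  have "suffix b (b @ u @ v)" unfolding eq using v(1) by (simp add: suffix_appendI)
  moreover have "w \<in> L" if w: "sublist w (b @ u @ v)" "length w = n" for w
  proof -
    have "sublist w ((b @ u) @ v)" using w by simp
    then consider "sublist w (b @ u)" | "sublist w v"
      | w1 w2 where "w = w1 @ w2" "suffix w1 (b @ u)" "prefix w2 v"
      unfolding sublist_append by blast
    then show ?thesis
    proof cases
      case 1 then show ?thesis using u(2) w by blast
    next
      case 2
      then have "sublist w (b @ v)" by (metis sublist_append)
      then show ?thesis using v(2) w(2) by blast
    next
      case 3
      then have "suffix w1 b"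
        using suffix_length_suffix[OF 3(2) u(1)] w(2) n by simp
      then have "sublist w (b @ v)" using 3(1,3) by (metis sublist_append)
      then show ?thesis using v(2) w by blast
    qed
  qed
  ultimately show ?thesis by (simp add: return_words_def)
qed

lemma language_sublist:
  assumes "x \<in> X" "sublist w (word x i m)" shows "w \<in> language (length w) X"
  using assms by (metis sublist_wordD word_in_language)

lemma return_words_between_occurrences:
  assumes x: "x \<in> X" and b: "word x i (length b) = b" "word x j (length b) = b" and ij: "i \<le> j"
  shows "word x (i + int (length b)) (nat (j - i)) \<in> return_words n (language n X) b"
proof -
  have eq: "b @ word x (i + int (length b)) (nat (j - i)) = word x i (length b + nat (j - i))"
    by (simp add: word_add b)
  also have "\<dots> = word x i (nat (j - i)) @ b"
    using word_add[of x i "nat (j - i)" "length b"] ij b by (simp add: add.commute)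
  finally have eq2: "b @ word x (i + int (length b)) (nat (j - i)) = word x i (nat (j - i)) @ b" .
  show ?thesis
    unfolding return_words_def
  proof (intro CollectI conjI allI impI)
    show "suffix b (b @ word x (i + int (length b)) (nat (j - i)))"
      unfolding eq2 by (simp add: suffix_def)
    show "w \<in> language n X" 
      if "sublist w (b @ word x (i + int (length b)) (nat (j - i)))" "length w = n" for w
      using that language_sublist[OF x] unfolding eq by blast
  qed
qed

lemma concat_in_return_words:
  assumes n: "n \<le> length b" and nil: "[] \<in> return_words n L b"
    and bs: "bs \<in> lists (return_words n L b)"
  shows "concat bs \<in> return_words n L b"
  using bs by induction (auto simp: nil intro: return_words_append n)

text \<open>
  The lengths of the return words to \<open>b\<close> form an additive semigroup. By total transitivity \<open>b\<close> occurs, in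
  one point, at a position divisible by \<open>d\<close> and at one congruent to 1, and the distance of the two
  occurrences is a return length that \<open>d\<close> does not divide. So there are return words of consecutive
  lengths. To make them contain all words of length \<open>n\<close>, a fixed long return word is put in front of
  both; it is found between two disjoint occurrences of a word \<open>W\<close> that ends in \<open>b\<close> and contains all
  words of length \<open>n\<close>.
\<close>

lemma return_words_of_consecutive_lengths:
  assumes X: "subshift X" and tt: "totally_transitive X" and n: "n \<ge> 1"
  obtains D1 D2 where "length D2 = Suc (length D1)"
    "\<forall>w\<in>language n X. sublist w D1 \<and> sublist w D2"
    "\<forall>bs\<in>lists {D1, D2}. \<forall>w. sublist w (concat bs) \<longrightarrow> length w = n \<longrightarrow> w \<in> language n X"
proof -
  obtain x where x: "x \<in> X"
    and "\<And>w n r. w \<in> language n X \<Longrightarrow> \<exists>i. [i = r] (mod int 1) \<and> word x i n = w"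
    using totally_transitive_occurrences[OF X tt, of 1] by auto
  then have "\<forall>w\<in>language n X. \<exists>i. word x i n = w" by blast
  then obtain pos where pos: "\<And>w. w \<in> language n X \<Longrightarrow> word x (pos w) n = w" by metis
  obtain k :: nat where k: "\<And>w. w \<in> language n X \<Longrightarrow> \<bar>pos w\<bar> \<le> int k"
  proof -
    have "finite ((\<lambda>w. nat \<bar>pos w\<bar>) ` language n X)" using finite_language[OF X] by simp
    then obtain k where "\<And>w. w \<in> language n X \<Longrightarrow> nat \<bar>pos w\<bar> \<le> k"
      unfolding finite_nat_set_iff_bounded_le by blast
    then show ?thesis by (intro that[of k]) force
  qed
  define l where "l = 2 * k + n"
  define W where "W = word x (- int k) l"
  have W: "W \<in> language l X" "length W = l" using x by (auto simp: W_def word_in_language)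
  have subW: "sublist w W" if "w \<in> language n X" for w
    using sublist_word[of "- int k" "pos w" n l x] pos[OF that] k[OF that] by (simp add: W_def l_def)
  define b where "b = drop (l - n) W"
  have b: "length b = n" using W by (simp add: b_def l_def)
  have bW: "word y (i + int (l - n)) n = b" if "word y i l = W" for y i
    using that b unfolding b_def by (metis drop_word diff_diff_cancel l_def le_add2)
  have bL: "b \<in> language n X" 
    using word_in_language[OF x] bW[OF W_def[symmetric]] by metis
  define R where "R = return_words n (language n X) b"
  have nil: "[] \<in> R"
  proof -
    have "w = b" if w: "sublist w b" "length w = n" for w
    proof -
      obtain l r where "b = l @ w @ r" using w(1) by (auto simp: sublist_def)
      then show ?thesis using b w(2) by simp
    qed
    then show ?thesis using bL by (auto simp: R_def return_words_def)
  qed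
  have app: "u @ v \<in> R" if "u \<in> R" "v \<in> R" for u v
    using that return_words_append[of u n _ b v] b by (simp add: R_def)
  have between: "word y (i + int n) (nat (j - i)) \<in> R"
    if "y \<in> X" "word y i n = b" "word y j n = b" "i \<le> j" for y i j
    using return_words_between_occurrences[of y X i b j n] that b by (simp add: R_def)
  obtain k where "k \<in> length ` R" "Suc k \<in> length ` R"
  proof (rule additive_semigroup_consecutive[of "length ` R"])
    show "0 \<in> length ` R" using nil by force
    show "s + t \<in> length ` R" if "s \<in> length ` R" "t \<in> length ` R" for s t
      using that app by (metis (no_types, opaque_lifting) imageE imageI length_append)
    fix d :: nat assume d: "2 \<le> d"
    then obtain y where y: "y \<in> X"
      and occ: "\<And>w n r. w \<in> language n X \<Longrightarrow> \<exists>i. [i = r] (mod int d) \<and> word y i n = w"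
      using totally_transitive_occurrences[OF X tt, of d] by auto
    obtain i where i: "[i = 0] (mod int d)" "word y i n = b" using occ[OF bL] by blast
    obtain j where j: "[j = 1] (mod int d)" "word y j n = b" using occ[OF bL] by blast
    have nd: "\<not> int d dvd i - j"
    proof
      assume "int d dvd i - j"
      then have "[i = j] (mod int d)" by (simp add: cong_iff_dvd_diff)
      then have "[0 = 1] (mod int d)" using i j by (meson cong_sym cong_trans)
      then show False using d by (simp add: cong_def)
    qed
    have "nat \<bar>i - j\<bar> \<in> length ` R"
    proof (cases "i \<le> j")
      case True
      then show ?thesis using between[OF y i(2) j(2)] by (force intro: image_eqI[of _ length])
    next
      case False
      then show ?thesis using between[OF y j(2) i(2)] by (force intro: image_eqI[of _ length])
    qed
    moreover have "\<not> d dvd nat \<bar>i - j\<bar>" using nd by (simp add: int_dvd_int_iff[symmetric])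
    ultimately show "\<exists>t\<in>length ` R. \<not> d dvd t" by blast
  qed
  then obtain u v where uv: "u \<in> R" "v \<in> R" "length v = Suc (length u)" by auto
  have "l \<ge> 1" using n by (simp add: l_def)
  obtain y where y: "y \<in> X"
    and occ: "\<And>w n r. w \<in> language n X \<Longrightarrow> \<exists>i. [i = r] (mod int (2 * l)) \<and> word y i n = w"
    using totally_transitive_occurrences[OF X tt, of "2 * l"] \<open>l \<ge> 1\<close> by auto
  obtain i where i: "[i = 0] (mod int (2 * l))" "word y i l = W" using occ[OF W(1)] by blast
  obtain j where j: "[j = int l] (mod int (2 * l))" "word y j l = W" using occ[OF W(1)] by blast
  \<comment> \<open>The two positions are congruent to 0 and to l modulo 2 l, so that these occurrences of W
    are disjoint.\<close>
  have far: "\<bar>i - j\<bar> \<ge> int l"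
  proof -
    obtain q where q: "i = int (2 * l) * q" using i(1) by (auto simp: cong_0_iff)
    obtain q' where q': "j = int l + int (2 * l) * q'" using j(1) by (metis cong_iff_lin cong_sym)
    have "i - j = int l * (2 * q - 2 * q' - 1)" by (simp add: q q' algebra_simps)
    then have "\<bar>i - j\<bar> = int l * \<bar>2 * q - 2 * q' - 1\<bar>" by (simp add: abs_mult)
    moreover have "\<bar>2 * q - 2 * q' - 1\<bar> \<ge> 1" by presburger
    ultimately show ?thesis using mult_left_mono[of 1 "\<bar>2 * q - 2 * q' - 1\<bar>" "int l"] by simp
  qed
  have "\<exists>E\<in>R. sublist W E"
  proof -
    have *: "\<exists>E\<in>R. sublist W E" if ij: "word y i l = W" "word y j l = W" "i + int l \<le> j" for i j
    proof
      let ?E = "word y (i + int (l - n) + int n) (nat (j - i))"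
      show "?E \<in> R"
        using between[OF y bW[OF ij(1)] bW[OF ij(2)]] ij(3) by simp
      have "sublist (word y j l) ?E"
        using ij(3) by (intro sublist_word) (auto simp: l_def)
      then show "sublist W ?E" using ij by simp
    qed
    show ?thesis using *[of i j] *[of j i] i j far by linarith
  qed
  then obtain E where E: "E \<in> R" "sublist W E" by blast
  show ?thesis
  proof (rule that[of "E @ v" "E @ u"])
    show "length (E @ v) = Suc (length (E @ u))" using uv by simp
    show "\<forall>w\<in>language n X. sublist w (E @ u) \<and> sublist w (E @ v)"
      using subW E(2) by (auto simp: sublist_append intro: sublist_order.order.trans)
    show "\<forall>bs\<in>lists {E @ u, E @ v}. \<forall>w. sublist w (concat bs) \<longrightarrow> length w = n \<longrightarrow> w \<in> language n X"
    proof (intro ballI allI impI)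
      fix bs w assume bs: "bs \<in> lists {E @ u, E @ v}" and w: "sublist w (concat bs)" "length w = n"
      have "bs \<in> lists R" using bs app E uv by (auto simp: lists_eq_set)
      then have "concat bs \<in> R"
        using concat_in_return_words[of n b "language n X" bs] nil b by (simp add: R_def)
      then show "w \<in> language n X"
        using w by (auto simp: R_def return_words_def sublist_append)
    qed
  qed
qed

section \<open>Coded subshifts\<close>

text \<open>
  The subshift generated by the free concatenations of the blocks in \<open>B\<close>.
\<close>

definition coded_shift :: "int list set \<Rightarrow> (int \<Rightarrow> int) set" where
  "coded_shift B = sequences_with {w. \<exists>bs\<in>lists B. sublist w (concat bs)}"

text \<open>
  One point that contains every concatenation of blocks shows at once that the coded shift is nonempty,
  that every factor of a concatenation belongs to its language, and that it is totally transitive.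
  It lists all concatenations one after the other to the right of the origin and repeats the block \<open>U\<close>
  to the left.
\<close>

lemma coded_shift_point:
  assumes cB: "countable B" and nB: "\<And>b. b \<in> B \<Longrightarrow> b \<noteq> []" and U: "U \<in> B"
  obtains x where "x \<in> coded_shift B" "\<And>bs. bs \<in> lists B \<Longrightarrow> \<exists>i. word x i (length (concat bs)) = concat bs"
proof -
  define e where "e = from_nat_into (lists B - {[]})"
  have "[U] \<in> lists B - {[]}" using U by simp
  then have ne: "lists B - {[]} \<noteq> {}" by blast
  have range_e: "range e = lists B - {[]}"
    unfolding e_def using ne cB by (intro range_from_nat_into) auto
  have e: "e k \<in> lists B" "e k \<noteq> []" for k using range_e by auto
  have e1: "length (concat (e k)) \<ge> 1" for k
    using e[of k] nB by (cases "e k") (auto simp: Suc_le_eq)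
  define P where "P k = concat (map (concat \<circ> e) [0..<k])" for k
  have P_Suc: "P (Suc k) = P k @ concat (e k)" for k by (simp add: P_def)
  have len_P: "k \<le> length (P k)" for k
  proof (induction k)
    case (Suc k) then show ?case using e1[of k] by (simp add: P_Suc)
  qed simp
  have P_prefix: "prefix (P k) (P (k + l))" for k l
    by (induction l) (auto simp: P_Suc)
  have P_nth: "P k ! i = P l ! i" if "i < length (P k)" "i < length (P l)" for k l i
    using that P_prefix[of k "l - k"] P_prefix[of l "k - l"]
    by (cases "k \<le> l") (auto simp: prefix_def nth_append)
  have P_concat: "\<exists>bs\<in>lists B. P k = concat bs" for k
  proof (induction k)
    case 0 show ?case by (auto simp: P_def intro: bexI[of _ "[]"])
  next
    case (Suc k)
    then obtain bs where "bs \<in> lists B" "P k = concat bs" by blast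
    then show ?case using e(1)[of k] by (intro bexI[of _ "bs @ e k"]) (auto simp: P_Suc)
  qed
  define p where "p = length U"
  have p: "p > 0" using nB[OF U] by (simp add: p_def)
  define x where "x i = (if 0 \<le> i then P (Suc (nat i)) ! nat i else U ! nat (i mod int p))" for i
  have x_P: "word x 0 (length (P k)) = P k" for k
  proof (rule nth_equalityI)
    fix i assume "i < length (word x 0 (length (P k)))"
    then have "i < length (P k)" "i < length (P (Suc i))" using len_P[of "Suc i"] by simp_all
    then show "word x 0 (length (P k)) ! i = P k ! i"
      using P_nth[of i "Suc i" k] by (simp add: x_def)
  qed simp
  have x_U: "word x (- int (j * p)) (j * p) = concat (replicate j U)" for j
  proof (induction j)
    case 0 show ?case by (simp add: word_def)
  next
    case (Suc j)
    have "word x (- int (Suc j * p)) p = U"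
    proof (rule nth_equalityI)
      fix i assume "i < length (word x (- int (Suc j * p)) p)"
      then have i: "i < p" by simp
      have "0 \<le> int j * int p" "int i < int p" using i by simp_all
      then have "int p + int j * int p > int i" by linarith
      then have neg: "- int (Suc j * p) + int i < 0" by simp
      have "(- int (Suc j * p) + int i) mod int p = (int i + (- int (Suc j)) * int p) mod int p"
        by (simp add: algebra_simps)
      also have "\<dots> = int i" using i by (subst mod_mult_self1) simp
      finally show "word x (- int (Suc j * p)) p ! i = U ! i"
        using neg i by (simp add: x_def)
    qed (simp add: p_def)
    moreover have "word x (- int (Suc j * p)) (p + j * p) =
        word x (- int (Suc j * p)) p @ word x (- int (j * p)) (j * p)"
      using word_add[of x "- int (Suc j * p)" p "j * p"] by (simp add: algebra_simps)
    ultimately show ?case using Suc by simp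
  qed
  show ?thesis
  proof (rule that[of x])
    have "\<exists>bs\<in>lists B. sublist (word x i n) (concat bs)" for i n
    proof -
      define j where "j = nat \<bar>i\<bar>"
      define k where "k = nat \<bar>i\<bar> + n"
      obtain bs where bs: "bs \<in> lists B" "P k = concat bs" using P_concat by blast
      have "word x (- int (j * p)) (j * p + length (P k)) = concat (replicate j U @ bs)"
        using word_add[of x "- int (j * p)" "j * p" "length (P k)"]
          x_P[of k] x_U[of j] bs(2) by (metis concat_append add.left_inverse)
      moreover have "sublist (word x i n) (word x (- int (j * p)) (j * p + length (P k)))"
      proof (rule sublist_word)
        have "int j * 1 \<le> int j * int p" using p by (intro mult_left_mono) auto
        then show "- int (j * p) \<le> i" by (simp add: j_def)
        show "i + int n \<le> - int (j * p) + int (j * p + length (P k))"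
          using len_P[of k] by (simp add: k_def)
      qed
      ultimately have "sublist (word x i n) (concat (replicate j U @ bs))" by metis
      moreover have "replicate j U @ bs \<in> lists B" using U bs by (auto simp: lists_eq_set)
      ultimately show ?thesis by blast
    qed
    then show "x \<in> coded_shift B" by (simp add: coded_shift_def sequences_with_def)
    fix bs assume bs: "bs \<in> lists B"
    show "\<exists>i. word x i (length (concat bs)) = concat bs"
    proof (cases "bs = []")
      case True then show ?thesis by (simp add: word_def)
    next
      case False
      then have "bs \<in> range e" unfolding range_e using bs by blast
      then obtain k where k: "bs = e k" by blast
      have "word x 0 (length (P k) + length (concat bs)) = P k @ concat bs"
        using x_P[of "Suc k"] by (simp add: P_Suc k)
      then have "word x (int (length (P k))) (length (concat bs)) = concat bs"
        by (simp add: word_add x_P)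
      then show ?thesis by blast
    qed
  qed
qed

lemma coded_shift_subshift_language:
  assumes fB: "finite B" and nB: "\<And>b. b \<in> B \<Longrightarrow> b \<noteq> []" and neB: "B \<noteq> {}"
  shows "subshift (coded_shift B)"
    and "language n (coded_shift B) = {w. length w = n \<and> (\<exists>bs\<in>lists B. sublist w (concat bs))}"
proof -
  obtain U where U: "U \<in> B" using neB by blast
  obtain x where x: "x \<in> coded_shift B"
    and occ: "\<And>bs. bs \<in> lists B \<Longrightarrow> \<exists>i. word x i (length (concat bs)) = concat bs"
    using coded_shift_point[of B U] U nB fB by (metis countable_finite)
  have "{c. [c] \<in> {w. \<exists>bs\<in>lists B. sublist w (concat bs)}} \<subseteq> (\<Union>b\<in>B. set b)"
    by (auto simp: sublist_def lists_eq_set dest!: arg_cong[of _ _ set]) blast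
  then have "finite {c. [c] \<in> {w. \<exists>bs\<in>lists B. sublist w (concat bs)}}"
    by (rule finite_subset) (use fB in auto)
  then show "subshift (coded_shift B)"
    unfolding coded_shift_def by (rule subshift_sequences_with) (use x in \<open>auto simp: coded_shift_def\<close>)
  show "language n (coded_shift B) = {w. length w = n \<and> (\<exists>bs\<in>lists B. sublist w (concat bs))}"
  proof (intro equalityI subsetI)
    fix w assume "w \<in> language n (coded_shift B)"
    then show "w \<in> {w. length w = n \<and> (\<exists>bs\<in>lists B. sublist w (concat bs))}"
      by (auto simp: language_eq coded_shift_def sequences_with_def)
  next
    fix w assume "w \<in> {w. length w = n \<and> (\<exists>bs\<in>lists B. sublist w (concat bs))}"
    then obtain bs where bs: "length w = n" "bs \<in> lists B" "sublist w (concat bs)" by blast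
    then obtain i where "word x i (length (concat bs)) = concat bs" using occ by blast
    then have "sublist w (word x i (length (concat bs)))" using bs by simp
    then show "w \<in> language n (coded_shift B)" using language_sublist[OF x] bs(1) by blast
  qed
qed

text \<open>
  A word \<open>w\<close> that occurs in a concatenation can be followed by copies of \<open>U\<close> and \<open>V\<close> so that the length
  of the result \<open>C\<close> is congruent to 1 modulo \<open>m\<close>, because the lengths of the two blocks differ by 1. In the
  \<open>m\<close>-th power of \<open>C\<close> the word \<open>w\<close> then occurs in every residue class, wherever that power is placed.
  Hence the point that contains all concatenations has dense orbits under all powers of the shift.
\<close>

lemma coded_shift_totally_transitive:
  assumes U: "U \<noteq> []" and V: "length V = Suc (length U)"
  shows "totally_transitive (coded_shift {U, V})"
proof -
  let ?B = "{U, V}"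
  have nB: "b \<noteq> []" if "b \<in> ?B" for b using that U V by auto
  obtain x where x: "x \<in> coded_shift ?B"
    and occ: "\<And>bs. bs \<in> lists ?B \<Longrightarrow> \<exists>i. word x i (length (concat bs)) = concat bs"
    using coded_shift_point[of ?B U] nB by (metis countable_finite finite.emptyI finite.insertI insertI1)
  show ?thesis
  proof (rule totally_transitiveI[OF x])
    fix w n m r assume "w \<in> language n (coded_shift ?B)" and m: "m \<ge> (1::nat)"
    then obtain bs where w: "length w = n" and bs: "bs \<in> lists ?B" "sublist w (concat bs)"
      using coded_shift_subshift_language(2)[of ?B n] nB by auto
    obtain l t where lt: "concat bs = l @ w @ t" using bs(2) by (auto simp: sublist_def)
    \<comment> \<open>m - j copies of U and j copies of V have total length j modulo m.\<close>
    define j where "j = nat ((1 - int (length (concat bs))) mod int m)"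
    have j: "j < m" "[int j = 1 - int (length (concat bs))] (mod int m)"
      using m by (auto simp: j_def cong_def nat_less_iff)
    define cs where "cs = bs @ replicate (m - j) U @ replicate j V"
    have cs: "cs \<in> lists ?B" using bs by (auto simp: cs_def lists_eq_set)
    have len_rep: "length (concat (replicate k u)) = k * length u" for k and u :: "int list"
      by (induction k) auto
    have "length (concat cs) = length (concat bs) + ((m - j) * length U + j * Suc (length U))"
      by (simp add: cs_def len_rep V)
    also have "(m - j) * length U + j * Suc (length U) = j + ((m - j) + j) * length U"
      unfolding add_mult_distrib by simp
    also have "(m - j) + j = m" using j(1) by simp
    finally have "int (length (concat cs)) = int (length (concat bs)) + int j + int m * int (length U)"
      by simp
    then have len_cs: "[int (length (concat cs)) = 1] (mod int m)"
      using cong_add[OF cong_refl[of "int (length (concat bs))"] j(2)] by (simp add: cong_def)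
    let ?cs = "concat (replicate m cs)"
    have "?cs \<in> lists ?B" using cs by (auto simp: lists_eq_set)
    then obtain q where q: "word x q (length (concat ?cs)) = concat ?cs" using occ by blast
    define h where "h = nat ((r - q - int (length l)) mod int m)"
    have h: "h < m" "[int h = r - q - int (length l)] (mod int m)"
      using m by (auto simp: h_def cong_def nat_less_iff)
    have rep: "concat (concat (replicate k cs)) = concat (replicate k (concat cs))" for k
      by (induction k) auto
    have split: "concat ?cs = concat (replicate h (concat cs)) @ concat cs @ concat (replicate (m - h - 1) (concat cs))"
    proof -
      have "replicate m (concat cs) = replicate h (concat cs) @ concat cs # replicate (m - h - 1) (concat cs)"
        using h(1) by (metis Suc_diff_Suc diff_Suc_eq_diff_pred diff_commute le_add_diff_inverse less_imp_le_nat replicate_Suc replicate_add One_nat_def)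
      then show ?thesis by (simp add: rep)
    qed
    then obtain t' where t': "concat ?cs = (concat (replicate h (concat cs)) @ l) @ w @ t'"
      by (simp add: cs_def lt)
    define s where "s = length (concat (replicate h (concat cs)) @ l)"
    have "w = take n (drop s (concat ?cs))" unfolding t' s_def using w by simp
    also have "\<dots> = word x (q + int s) n"
    proof -
      have "length (concat ?cs) = s + n + length t'" unfolding t' s_def using w by simp
      then show ?thesis
        by (subst q[symmetric]) (simp add: drop_word take_word)
    qed
    finally have ws: "word x (q + int s) n = w" by simp
    have "int s = int h * int (length (concat cs)) + int (length l)"
      by (simp add: s_def len_rep)
    moreover have "[int h * int (length (concat cs)) = (r - q - int (length l)) * 1] (mod int m)"
      by (intro cong_mult h len_cs)
    ultimately have "[q + int s = q + ((r - q - int (length l)) * 1 + int (length l))] (mod int m)"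
      by (simp only:) (intro cong_add cong_refl)
    then have "[q + int s = r] (mod int m)" by (simp only: mult_1_right) (simp add: algebra_simps)
    then show "\<exists>i. [i = r] (mod int m) \<and> word x i n = w" using ws by blast
  qed
qed

section \<open>Letter frequencies in coded subshifts\<close>

text \<open>
  The error in approximating the number of letters \<open>a\<close> by the frequency \<open>f\<close>. It is additive under
  concatenation, so that bounds for blocks pass to concatenations of blocks.
\<close>

definition deviation :: "int \<Rightarrow> real \<Rightarrow> int list \<Rightarrow> real" where
  "deviation a f w = real (count_list w a) - f * real (length w)"

lemma deviation_append [simp]: "deviation a f (u @ v) = deviation a f u + deviation a f v"
  by (simp add: deviation_def algebra_simps)

lemma deviation_Nil [simp]: "deviation a f [] = 0"
  by (simp add: deviation_def)

lemma deviation_le_length: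
  assumes "0 \<le> f" "f \<le> 1" shows "\<bar>deviation a f w\<bar> \<le> length w"
proof -
  have "count_list w a \<le> length w" by (rule count_le_length)
  moreover have "0 \<le> f * length w" "f * length w \<le> length w"
    using assms by (auto intro: mult_left_le_one_le)
  ultimately show ?thesis unfolding deviation_def by linarith
qed

context
  fixes B :: "int list set" and a :: int and f c :: real and K :: nat
  assumes f: "0 \<le> f" "f \<le> 1" and c: "0 \<le> c"
    and block: "\<And>b. b \<in> B \<Longrightarrow> \<bar>deviation a f b\<bar> \<le> c * length b"
    and K: "\<And>b. b \<in> B \<Longrightarrow> length b \<le> K"
begin

lemma deviation_piece: "b \<in> B \<Longrightarrow> length w \<le> length b \<Longrightarrow> \<bar>deviation a f w\<bar> \<le> c * length w + real K"
proof -
  assume b: "b \<in> B" "length w \<le> length b"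
  then have "length w \<le> K" using K by force
  moreover have "0 \<le> c * length w" using c by simp
  ultimately show ?thesis using deviation_le_length[OF f, of a w] by linarith
qed

lemma deviation_prefix_concat:
  assumes "bs \<in> lists B" "prefix w (concat bs)"
  shows "\<bar>deviation a f w\<bar> \<le> c * length w + real K"
  using assms
proof (induction bs arbitrary: w)
  case Nil
  then show ?case by simp
next
  case (Cons b bs)
  then have "prefix w (b @ concat bs)" by simp
  then consider "prefix w b" | v where "w = b @ v" "prefix v (concat bs)"
    by (auto simp: prefix_append)
  then show ?case
  proof cases
    case 1
    then show ?thesis using Cons(1) by (intro deviation_piece) (auto dest: prefix_length_le)
  next
    case 2
    have "\<bar>deviation a f w\<bar> \<le> \<bar>deviation a f b\<bar> + \<bar>deviation a f v\<bar>" by (simp add: 2)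
    also have "\<dots> \<le> c * length b + (c * length v + real K)"
      using block[OF Cons(1)] Cons.IH[OF 2(2)] by (intro add_mono)
    finally show ?thesis by (simp add: 2 algebra_simps)
  qed
qed

text \<open>
  A factor of a concatenation is a concatenation of whole blocks up to a piece of a block at each end.
  The whole blocks contribute at most \<open>c\<close> per letter and the two ends at most \<open>K\<close> each.
\<close>

lemma deviation_sublist_concat:
  assumes "bs \<in> lists B" "sublist w (concat bs)"
  shows "\<bar>deviation a f w\<bar> \<le> c * length w + 2 * real K"
  using assms
proof (induction bs)
  case Nil
  then show ?case by simp
next
  case (Cons b bs)
  then have "sublist w (b @ concat bs)" by simp
  then consider "sublist w b" | "sublist w (concat bs)"
    | u v where "w = u @ v" "suffix u b" "prefix v (concat bs)"
    by (auto simp: sublist_append)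
  then show ?case
  proof cases
    case 1
    then show ?thesis using deviation_piece[OF Cons(1), of w] by (auto dest: sublist_length_le)
  next
    case 2
    then show ?thesis by (rule Cons.IH)
  next
    case 3
    have "\<bar>deviation a f w\<bar> \<le> \<bar>deviation a f u\<bar> + \<bar>deviation a f v\<bar>" by (simp add: 3)
    also have "\<dots> \<le> (c * length u + real K) + (c * length v + real K)"
      using deviation_piece[OF Cons(1), of u] deviation_prefix_concat[OF Cons(2) 3(3)] 3(2)
      by (intro add_mono) (auto dest: suffix_length_le)
    finally show ?thesis by (simp add: 3 algebra_simps)
  qed
qed

end

lemma count_list_sublist: "sublist u w \<Longrightarrow> count_list u a \<le> count_list w a"
  by (auto simp: sublist_def)

section \<open>Perturbing the frequency of a letter\<close>

lemma infinite_subshift_letters: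
  assumes X: "subshift X" and inf: "infinite X" and a: "[a] \<in> language 1 X"
  obtains c where "[c] \<in> language 1 X" "c \<noteq> a"
proof -
  have "\<exists>x\<in>X. \<exists>i. x i \<noteq> a"
  proof (rule ccontr)
    assume "\<not> ?thesis"
    then have "X \<subseteq> {\<lambda>_. a}" by auto
    then show False using inf finite_subset by blast
  qed
  then obtain x i where "x \<in> X" "x i \<noteq> a" by blast
  then show thesis using that[of "x i"] word_in_language[of x X i 1] by (simp add: word_1)
qed

text \<open>
  Let \<open>D1\<close> and \<open>D2\<close> be return words of lengths \<open>p\<close> and \<open>p + 1\<close> that contain all words of length \<open>n + 1\<close>.
  The letter \<open>a\<close> has different frequencies in them: if they were equal, \<open>p\<close> would divide the number of
  letters \<open>a\<close> in \<open>D1\<close>, which lies strictly between 0 and \<open>p\<close>. So one of the two words, called \<open>C\<close>, has a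
  frequency \<open>f\<close> different from \<open>s\<close>. The blocks that consist of \<open>M\<close> copies of \<open>C\<close> followed by \<open>D1\<close> or \<open>D2\<close>
  again have consecutive lengths, and generate a totally transitive subshift with the same words of
  length \<open>n + 1\<close>. For large \<open>M\<close> the frequency of \<open>a\<close> in its long words is uniformly close to \<open>f\<close>, hence on
  one side of \<open>s\<close>.
\<close>

lemma letter_frequency_perturbation:
  fixes s :: real
  assumes X: "X \<in> infinite_tt" and a: "[a] \<in> language 1 X"
  obtains Z N where "Z \<in> infinite_tt" "language n Z = language n X"
    "(\<forall>w\<in>language N Z. s * N + 1 \<le> count_list w a) \<or> (\<forall>w\<in>language N Z. count_list w a \<le> s * N - 1)"
proof -
  have X': "subshift X" "infinite X" "totally_transitive X" using X by (auto simp: infinite_tt_def)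
  let ?n = "Suc n"
  obtain c where c: "[c] \<in> language 1 X" "c \<noteq> a" using infinite_subshift_letters[OF X'(1,2) a] .
  obtain D1 D2 where len: "length D2 = Suc (length D1)"
    and cov: "\<forall>w\<in>language ?n X. sublist w D1 \<and> sublist w D2"
    and sub: "\<forall>bs\<in>lists {D1, D2}. \<forall>w. sublist w (concat bs) \<longrightarrow> length w = ?n \<longrightarrow> w \<in> language ?n X"
    by (rule return_words_of_consecutive_lengths[OF X'(1,3), of ?n]) auto
  have letter: "count_list D1 d > 0" if d: "[d] \<in> language 1 X" for d
  proof -
    obtain w where w: "w \<in> language ?n X" "[d] = take 1 w"
      using d language_take[of 1 ?n X] by auto
    then have "sublist [d] D1" using cov by (metis sublist_order.order.trans sublist_take)
    then show ?thesis using count_list_sublist[of "[d]" D1 d] by simp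
  qed
  define p where "p = length D1"
  have a_pos: "count_list D1 a > 0" using letter a by blast
  have a_less: "count_list D1 a < p"
  proof -
    have "count_list D1 a + count_list D1 c \<le> length D1"
      using c(2) by (induction D1) auto
    then show ?thesis using letter[OF c(1)] by (simp add: p_def)
  qed
  have p: "p > 0" using a_less by simp
  define freq where "freq D = real (count_list D a) / real (length D)" for D
  \<comment> \<open>This is where aperiodicity enters: consecutive numbers are coprime.\<close>
  have "freq D1 \<noteq> freq D2"
  proof
    assume "freq D1 = freq D2"
    then have "real (count_list D1 a * Suc p) = real (count_list D2 a * p)"
      using p len by (simp add: freq_def p_def field_simps)
    then have "count_list D1 a * Suc p = count_list D2 a * p" by (simp only: of_nat_eq_iff)
    then have "p dvd count_list D1 a * Suc p" by simp
    then have "p dvd count_list D1 a" by (simp add: coprime_dvd_mult_left_iff)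
    then show False using a_pos a_less by (simp add: nat_dvd_not_less)
  qed
  then obtain C where C: "C \<in> {D1, D2}" "freq C \<noteq> s" by (metis insertI1 insertI2)
  define f where "f = freq C"
  have lenC: "length C > 0" "p \<le> length C" using C(1) p len by (auto simp: p_def)
  have f01: "0 \<le> f" "f \<le> 1"
    using count_le_length[of C a] lenC by (auto simp: f_def freq_def divide_le_eq_1)
  have devC: "deviation a f C = 0" using lenC by (simp add: deviation_def f_def freq_def)
  define \<delta> where "\<delta> = \<bar>f - s\<bar>"
  have \<delta>: "\<delta> > 0" using C(2) by (simp add: \<delta>_def f_def)
  \<comment> \<open>For this M the blocks deviate from f by less than half of the gap per letter; N below makes
    the two incomplete blocks at the ends of a word negligible.\<close>
  obtain M :: nat where M: "real M > 2 * (p + 1) / \<delta>" using reals_Archimedean2 by blast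
  have M0: "real M > 0" using M \<delta> by (smt (verit) divide_nonneg_pos of_nat_0_le_iff)
  define CM where "CM = concat (replicate M C)"
  have lenCM: "length CM = M * length C" unfolding CM_def by (induction M) auto
  have devCM: "deviation a f CM = 0" unfolding CM_def by (induction M) (auto simp: devC)
  define U where "U = CM @ D1"
  define V where "V = CM @ D2"
  let ?B = "{U, V}"
  let ?c = "(p + 1) / M"
  have block: "\<bar>deviation a f b\<bar> \<le> ?c * length b" if b: "b \<in> ?B" for b
  proof -
    obtain D where D: "b = CM @ D" "length D \<le> p + 1" using b len by (auto simp: U_def V_def p_def)
    have "\<bar>deviation a f b\<bar> \<le> p + 1"
      using deviation_le_length[OF f01, of a D] D by (simp add: devCM)
    also have "\<dots> = ?c * M" using M0 by simp
    also have "\<dots> \<le> ?c * length b"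
    proof (rule mult_left_mono)
      have "M * 1 \<le> M * length C" using lenC(1) by (intro mult_le_mono2) linarith
      then show "real M \<le> real (length b)" by (simp only: of_nat_le_iff D lenCM length_append)
    qed simp
    finally show ?thesis .
  qed
  have U: "U \<noteq> []" and V: "length V = Suc (length U)" using p len by (auto simp: U_def V_def p_def)
  define Z where "Z = coded_shift ?B"
  have nB: "b \<noteq> []" if "b \<in> ?B" for b using that U V by auto
  have Z: "subshift Z" unfolding Z_def by (rule coded_shift_subshift_language) (use nB in auto)
  have langZ: "language k Z = {w. length w = k \<and> (\<exists>bs\<in>lists ?B. sublist w (concat bs))}" for k
    unfolding Z_def by (rule coded_shift_subshift_language) (use nB in auto)
  have ttZ: "totally_transitive Z" unfolding Z_def by (rule coded_shift_totally_transitive[OF U V])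
  have lang: "language ?n Z = language ?n X"
  proof (intro equalityI subsetI)
    fix w assume "w \<in> language ?n Z"
    then obtain bs where bs: "length w = ?n" "bs \<in> lists ?B" "sublist w (concat bs)"
      by (auto simp: langZ)
    have "\<exists>cs\<in>lists {D1, D2}. concat cs = concat bs"
      using bs(2)
    proof induction
      case Nil then show ?case by (auto intro: bexI[of _ "[]"])
    next
      case (Cons b bs)
      then obtain cs where cs: "cs \<in> lists {D1, D2}" "concat cs = concat bs" by blast
      obtain D where D: "D \<in> {D1, D2}" "b = CM @ D" using Cons by (auto simp: U_def V_def)
      have "replicate M C @ D # cs \<in> lists {D1, D2}"
        using D(1) C(1) cs(1) by (auto simp: lists_eq_set)
      moreover have "concat (replicate M C @ D # cs) = concat (b # bs)"
        by (simp add: cs D CM_def)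
      ultimately show ?case by blast
    qed
    then show "w \<in> language ?n X" using sub bs by metis
  next
    fix w assume w: "w \<in> language ?n X"
    then have "sublist w (concat [U])"
      using cov w by (simp add: U_def sublist_append)
    then show "w \<in> language ?n Z" using length_language[OF w] by (auto simp: langZ intro!: bexI[of _ "[U]"])
  qed
  have "language 1 Z = language 1 X" using lang by (rule language_eq_mono) simp
  then have "infinite Z" using infinite_if_totally_transitive[OF Z ttZ] a c by metis
  then have ZTT: "Z \<in> infinite_tt" using Z ttZ by (simp add: infinite_tt_def)
  define K where "K = length V"
  obtain N :: nat where N: "real N > (2 * K + 1) * 2 / \<delta>" using reals_Archimedean2 by blast
  have close: "\<bar>count_list w a - f * N\<bar> \<le> \<delta> * N - 1" if w: "w \<in> language N Z" for w
  proof -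
    obtain bs where bs: "length w = N" "bs \<in> lists ?B" "sublist w (concat bs)"
      using w by (auto simp: langZ)
    have "\<bar>deviation a f w\<bar> \<le> ?c * length w + 2 * real K"
      by (rule deviation_sublist_concat[OF f01 _ block _ bs(2,3)]) (use V in \<open>auto simp: K_def\<close>)
    then have "\<bar>count_list w a - f * N\<bar> \<le> ?c * N + 2 * real K" by (simp add: deviation_def bs)
    also have "?c \<le> \<delta> / 2" using M \<delta> M0 by (simp add: field_simps)
    then have "?c * N \<le> \<delta> / 2 * N" by (rule mult_right_mono) simp
    also have "2 * real K \<le> \<delta> / 2 * N - 1" using N \<delta> by (simp add: field_simps)
    finally show ?thesis by (simp add: field_simps)
  qed
  have "(\<forall>w\<in>language N Z. s * N + 1 \<le> count_list w a) \<or> (\<forall>w\<in>language N Z. count_list w a \<le> s * N - 1)"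
  proof (cases "f > s")
    case True
    then have "\<delta> * N = f * N - s * N" by (simp add: \<delta>_def left_diff_distrib)
    then show ?thesis using close by (intro disjI1 ballI) (smt (verit))
  next
    case False
    then have "\<delta> * N = s * N - f * N" by (simp add: \<delta>_def left_diff_distrib abs_if)
    then show ?thesis using close by (intro disjI2 ballI) (smt (verit))
  qed
  then show ?thesis using that[OF ZTT language_eq_mono[OF lang]] by simp
qed

section \<open>Cylinders and the Borel sets of a subshift\<close>

lemma space_invariant_prob: "invariant_prob X M \<Longrightarrow> space M = X"
  by (metis invariant_prob_def sets_eq_imp_space_eq space_borel space_restrict_space inf_top_right)

definition cylinders :: "(int \<Rightarrow> int) set set" where
  "cylinders = (\<lambda>(i, n, w). {y. word y i n = w}) ` UNIV"

lemma cylinder_in_cylinders: "{y. word y i n = w} \<in> cylinders"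
  unfolding cylinders_def by (rule image_eqI[of _ _ "(i, n, w)"]) auto

lemma countable_cylinders: "countable cylinders"
  unfolding cylinders_def by simp

lemma open_cylinders: "C \<in> cylinders \<Longrightarrow> open C"
  by (auto simp: cylinders_def open_cylinder)

lemma open_eq_Union_cylinders:
  fixes G :: "(int \<Rightarrow> int) set"
  assumes "open G"
  shows "G = \<Union>{C \<in> cylinders. C \<subseteq> G}"
proof
  show "G \<subseteq> \<Union>{C \<in> cylinders. C \<subseteq> G}"
  proof
    fix z assume "z \<in> G"
    then obtain k where k: "\<And>y. word y (- int k) (2 * k + 1) = word z (- int k) (2 * k + 1) \<Longrightarrow> y \<in> G"
      using open_contains_cylinder[OF assms] by blast
    let ?C = "{y. word y (- int k) (2 * k + 1) = word z (- int k) (2 * k + 1)}"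
    have "?C \<subseteq> G" "z \<in> ?C" using k by auto
    then show "z \<in> \<Union>{C \<in> cylinders. C \<subseteq> G}" using cylinder_in_cylinders by blast
  qed
qed blast

lemma sets_borel_eq_cylinders:
  "sets (borel :: (int \<Rightarrow> int) measure) = sigma_sets UNIV cylinders"
proof
  have "sigma_sets UNIV cylinders \<subseteq> sigma_sets UNIV {S. open S}"
    by (rule sigma_sets_mono') (auto simp: open_cylinders)
  then show "sigma_sets UNIV cylinders \<subseteq> sets borel" by (simp add: sets_borel)
  have "sigma_sets UNIV {S. open S} \<subseteq> sigma_sets UNIV cylinders"
  proof (rule sigma_sets_mono, rule subsetI)
    fix G assume "G \<in> {S :: (int \<Rightarrow> int) set. open S}"
    then have G: "G = \<Union>{C \<in> cylinders. C \<subseteq> G}" by (intro open_eq_Union_cylinders) simp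
    interpret sigma_algebra UNIV "sigma_sets UNIV cylinders" by (rule sigma_algebra_sigma_sets) simp
    have "countable {C \<in> cylinders. C \<subseteq> G}"
      using countable_cylinders by (rule countable_subset[rotated]) blast
    then have "\<Union>{C \<in> cylinders. C \<subseteq> G} \<in> sigma_sets UNIV cylinders"
      by (rule countable_Union) (blast intro: sigma_sets.Basic)
    then show "G \<in> sigma_sets UNIV cylinders" using G by simp
  qed
  then show "sets borel \<subseteq> sigma_sets UNIV cylinders" by (simp add: sets_borel)
qed

lemma letter_set_in_sets:
  fixes X :: "(int \<Rightarrow> int) set"
  assumes "sets M = sets (restrict_space borel X)"
  shows "{x \<in> X. x i = a} \<in> sets M"
proof -
  have "{x \<in> X. x i = a} = X \<inter> {x. x i \<in> {a}}" by blast
  then show ?thesis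
    unfolding assms sets_restrict_space
    by (rule image_eqI) (intro borel_open open_coordinate)
qed

lemma continuous_shift_pow: "continuous_on UNIV (shift_pow k)"
  unfolding shift_pow_def
  by (intro continuous_on_coordinatewise_then_product continuous_on_product_coordinates)

lemma shift_pow_measurable:
  assumes X: "subshift X" and M: "sets M = sets (restrict_space borel X)"
  shows "shift_pow k \<in> measurable M M"
proof -
  have "shift_pow k \<in> measurable (restrict_space borel X) (restrict_space borel X)"
    by (intro measurable_restrict_space3 borel_measurable_continuous_onI continuous_shift_pow)
      (use subshift_shift_pow[OF X] in auto)
  then show ?thesis using measurable_cong_sets[OF M M] by simp
qed

lemma invariant_prob_shift_pow:
  assumes X: "subshift X" and M: "invariant_prob X M" and A: "A \<in> sets M"
  shows "emeasure M (shift_pow k -` A \<inter> X) = emeasure M A"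
proof -
  have sp: "space M = X" by (rule space_invariant_prob[OF M])
  have sM: "sets M = sets (restrict_space borel X)"
    and inv: "\<And>A. A \<in> sets M \<Longrightarrow> emeasure M (left_shift -` A \<inter> X) = emeasure M A"
    using M sp by (auto simp: invariant_prob_def)
  have ms: "shift_pow k -` A \<inter> X \<in> sets M" if "A \<in> sets M" for A k
    using measurable_sets[OF shift_pow_measurable[OF X sM] that] sp by simp
  have X_shift: "shift_pow k x \<in> X" if "x \<in> X" for x k using subshift_shift_pow[OF X that] .
  have nonneg: "emeasure M (shift_pow (int n) -` A \<inter> X) = emeasure M A" if A: "A \<in> sets M" for n A
  proof (induction n)
    case 0
    have "A \<subseteq> X" using sets.sets_into_space[OF A] sp by simp
    then show ?case by (simp add: vimage_def inf.absorb1 cong: Collect_cong)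
  next
    case (Suc n)
    have "shift_pow (int (Suc n)) x = shift_pow (int n) (left_shift x)" for x
      using shift_pow_add[of "int n" 1 x] by (simp add: shift_pow_1 add.commute)
    then have "shift_pow (int (Suc n)) -` A \<inter> X = left_shift -` (shift_pow (int n) -` A \<inter> X) \<inter> X"
      using X_shift[of _ 1] by (auto simp: shift_pow_1)
    then show ?case using inv[OF ms[OF A]] Suc by simp
  qed
  show ?thesis
  proof (cases "k \<ge> 0")
    case True
    then show ?thesis using nonneg[OF A, of "nat k"] by simp
  next
    case False
    then have k: "int (nat (- k)) = - k" by simp
    have "shift_pow (- k) -` (shift_pow k -` A \<inter> X) \<inter> X = A"
      using sets.sets_into_space[OF A] sp X_shift by (auto simp: shift_pow_add[symmetric])
    then show ?thesis using nonneg[OF ms[OF A, of k], of "nat (- k)"] k by simp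
  qed
qed

section \<open>Letter frequencies and invariant measures\<close>

text \<open>
  By invariance each of the \<open>N\<close> coordinates of a window contributes the same amount to the expected
  number of letters \<open>a\<close> in it.
\<close>

lemma letter_measure_window:
  assumes X: "subshift X" and M: "invariant_prob X M"
  shows "(\<integral>x. real (count_list (word x 0 N) a) \<partial>M) = N * measure M {x \<in> X. x 0 = a}"
    and "integrable M (\<lambda>x. real (count_list (word x 0 N) a))"
proof -
  interpret prob_space M using M by (simp add: invariant_prob_def)
  have sp: "space M = X" by (rule space_invariant_prob[OF M])
  have sM: "sets M = sets (restrict_space borel X)" using M by (simp add: invariant_prob_def)
  note set = letter_set_in_sets[OF sM]
  have eq: "measure M {x \<in> X. x i = a} = measure M {x \<in> X. x 0 = a}" for i
  proof -
    have "{x \<in> X. x i = a} = shift_pow i -` {x \<in> X. x 0 = a} \<inter> X"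
      using subshift_shift_pow[OF X] by (auto simp: shift_pow_def)
    then show ?thesis using invariant_prob_shift_pow[OF X M set, of i 0] by (simp add: measure_def)
  qed
  have cnt: "real (count_list (word x 0 N) a) = (\<Sum>j<N. indicat_real {x \<in> X. x (int j) = a} x)"
    if "x \<in> space M" for x
    using that sp by (induction N) (auto simp: word_def indicator_def)
  have int: "integrable M (indicat_real {x \<in> X. x i = a})" for i
    using set by (simp add: emeasure_eq_measure)
  show "integrable M (\<lambda>x. real (count_list (word x 0 N) a))"
    by (subst Bochner_Integration.integrable_cong[OF refl cnt]) (auto intro: int)
  have "(\<integral>x. real (count_list (word x 0 N) a) \<partial>M) = (\<Sum>j<N. measure M {x \<in> X. x (int j) = a})"
    by (subst Bochner_Integration.integral_cong[OF refl cnt])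
      (use int set in \<open>auto simp: Bochner_Integration.integral_sum sets.Int_space_eq2\<close>)
  then show "(\<integral>x. real (count_list (word x 0 N) a) \<partial>M) = N * measure M {x \<in> X. x 0 = a}"
    by (simp add: eq[of "int _"])
qed

lemma letter_measure_bounds:
  fixes t :: real
  assumes X: "subshift X" and M: "invariant_prob X M"
  shows "(\<And>w. w \<in> language N X \<Longrightarrow> t \<le> count_list w a) \<Longrightarrow> t \<le> N * measure M {x \<in> X. x 0 = a}"
    and "(\<And>w. w \<in> language N X \<Longrightarrow> count_list w a \<le> t) \<Longrightarrow> N * measure M {x \<in> X. x 0 = a} \<le> t"
proof -
  interpret prob_space M using M by (simp add: invariant_prob_def)
  have sp: "space M = X" by (rule space_invariant_prob[OF M])
  show "t \<le> N * measure M {x \<in> X. x 0 = a}" if "\<And>w. w \<in> language N X \<Longrightarrow> t \<le> count_list w a"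
    unfolding letter_measure_window(1)[OF X M, symmetric]
    by (intro integral_ge_const letter_measure_window(2)[OF X M] AE_I2) (auto simp: sp intro: that word_in_language)
  show "N * measure M {x \<in> X. x 0 = a} \<le> t" if "\<And>w. w \<in> language N X \<Longrightarrow> count_list w a \<le> t"
    unfolding letter_measure_window(1)[OF X M, symmetric]
    by (intro integral_le_const letter_measure_window(2)[OF X M] AE_I2) (auto simp: sp intro: that word_in_language)
qed

section \<open>Orbit equivalence and invariant measures\<close>

text \<open>
  Full group argument: the space splits into countably many pieces on each of which \<open>g\<close> is a fixed
  power of the shift, and the images of the pieces again partition the space as \<open>g\<close> is a bijection.
  On each piece \<open>g\<close> preserves the measure, and countable additivity finishes the proof.
\<close>

lemma orbit_bijection_preserves_invariant_prob:
  assumes X: "subshift X" and M: "invariant_prob X M"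
    and g: "g \<in> measurable M M" "bij_betw g X X"
    and orb: "\<And>x. x \<in> X \<Longrightarrow> \<exists>n. g x = shift_pow n x"
    and A: "A \<in> sets M"
  shows "emeasure M (g -` A \<inter> X) = emeasure M A"
proof -
  have sp: "space M = X" by (rule space_invariant_prob[OF M])
  have sM: "sets M = sets (restrict_space borel X)" using M by (simp add: invariant_prob_def)
  have X_shift: "shift_pow k x \<in> X" if "x \<in> X" for x k using subshift_shift_pow[OF X that] .
  have coord: "(\<lambda>x. x i) \<in> measurable M (count_space UNIV)" for i
    using letter_set_in_sets[OF sM]
    by (auto simp: measurable_count_space_eq_countable sp vimage_def Int_def conj_commute)
  define E where "E k = {x \<in> X. g x = shift_pow (int_decode k) x}" for k
  have E: "E k \<in> sets M" for k
  proof -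
    have [measurable]: "(\<lambda>x. g x i) \<in> measurable M (count_space UNIV)"
        "(\<lambda>x. x i) \<in> measurable M (count_space UNIV)" for i
      using measurable_compose[OF g(1) coord] coord by auto
    have "E k = {x \<in> space M. \<forall>i. g x i = x (i + int_decode k)}"
      by (auto simp: E_def sp shift_pow_def fun_eq_iff)
    also have "\<dots> \<in> sets M" by measurable
    finally show ?thesis .
  qed
  \<comment> \<open>The sets E k overlap in the periodic points.\<close>
  define F where "F = disjointed E"
  have F: "F k \<in> sets M" for k
    using sets.range_disjointed_sets[of E M] E by (auto simp: F_def)
  have disjF: "disjoint_family F" unfolding F_def by (rule disjoint_family_disjointed)
  have FE: "F k \<subseteq> E k" for k unfolding F_def by (rule disjointed_subset)
  have UF: "(\<Union>k. F k) = X"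
  proof -
    have "\<exists>k. x \<in> E k" if "x \<in> X" for x
      using orb[OF that] that unfolding E_def by (metis (mono_tags, lifting) int_encode_inverse mem_Collect_eq)
    then have "(\<Union>k. E k) = X" by (auto simp: E_def)
    then show ?thesis by (simp add: F_def UN_disjointed_eq)
  qed
  have gF: "g x = shift_pow (int_decode k) x" "x \<in> X" if "x \<in> F k" for x k
    using FE[of k] that by (auto simp: E_def)
  define G where "G k = shift_pow (- int_decode k) -` F k \<inter> X" for k
  have G: "G k \<in> sets M" for k
    using measurable_sets[OF shift_pow_measurable[OF X sM] F] sp by (simp add: G_def)
  have G_eq: "G k = g ` F k" for k
  proof (intro equalityI subsetI)
    fix y assume "y \<in> G k"
    then have "shift_pow (- int_decode k) y \<in> F k" by (simp add: G_def)
    moreover have "g (shift_pow (- int_decode k) y) = y"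
      using gF(1)[OF calculation] by (simp add: shift_pow_add[symmetric])
    ultimately show "y \<in> g ` F k" by (metis imageI)
  next
    fix y assume "y \<in> g ` F k"
    then obtain x where "x \<in> F k" "y = g x" by blast
    then show "y \<in> G k" using gF[of x k] X_shift by (simp add: G_def shift_pow_add[symmetric])
  qed
  have disjG: "disjoint_family G"
    unfolding disjoint_family_on_def
  proof (intro ballI impI)
    fix k l :: nat assume kl: "k \<noteq> l"
    have "G k \<inter> G l = g ` (F k \<inter> F l)"
      unfolding G_eq by (rule inj_on_image_Int[symmetric, of g X]) (use g(2) gF in \<open>auto simp: bij_betw_def\<close>)
    also have "F k \<inter> F l = {}" using disjF kl by (auto simp: disjoint_family_on_def)
    finally show "G k \<inter> G l = {}" by simp
  qed
  have UG: "(\<Union>k. G k) = X"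
    unfolding G_eq image_UN[symmetric] UF using g(2) by (simp add: bij_betw_def)
  have AX: "A \<subseteq> X" using sets.sets_into_space[OF A] sp by simp
  have piece: "g -` A \<inter> F k = shift_pow (int_decode k) -` (G k \<inter> A) \<inter> X" for k
  proof (intro equalityI subsetI)
    fix x assume "x \<in> g -` A \<inter> F k"
    then show "x \<in> shift_pow (int_decode k) -` (G k \<inter> A) \<inter> X"
      using gF[of x k] G_eq by force
  next
    fix x assume x: "x \<in> shift_pow (int_decode k) -` (G k \<inter> A) \<inter> X"
    then have "x \<in> F k" by (simp add: G_def shift_pow_add[symmetric])
    then show "x \<in> g -` A \<inter> F k" using gF[of x k] x by simp
  qed
  have "g -` A \<inter> X = (\<Union>k. g -` A \<inter> F k)" using UF by auto
  also have "emeasure M \<dots> = (\<Sum>k. emeasure M (g -` A \<inter> F k))"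
  proof (rule suminf_emeasure[symmetric])
    show "range (\<lambda>k. g -` A \<inter> F k) \<subseteq> sets M"
    proof (clarify)
      fix k
      have "g -` A \<inter> X \<inter> F k \<in> sets M" using measurable_sets[OF g(1) A] F sp by auto
      moreover have "g -` A \<inter> F k = g -` A \<inter> X \<inter> F k" using gF by auto
      ultimately show "g -` A \<inter> F k \<in> sets M" by simp
    qed
    show "disjoint_family (\<lambda>k. g -` A \<inter> F k)" using disjF by (auto simp: disjoint_family_on_def)
  qed
  also have "\<dots> = (\<Sum>k. emeasure M (G k \<inter> A))"
    unfolding piece by (intro suminf_cong invariant_prob_shift_pow[OF X M] sets.Int G A)
  also have "\<dots> = emeasure M (\<Union>k. G k \<inter> A)"
    by (rule suminf_emeasure) (use G A disjG in \<open>auto simp: disjoint_family_on_def\<close>)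
  also have "(\<Union>k. G k \<inter> A) = A" using UG AX by auto
  finally show ?thesis .
qed

text \<open>
  Conjugating the shift of \<open>Y\<close> by the homeomorphism gives a bijection of \<open>X\<close> that moves each point
  within its orbit, and so preserves the measure.
\<close>

lemma orbit_equivalence_transports_invariant_prob:
  assumes X: "subshift X" and Y: "subshift Y" and M: "invariant_prob X M"
    and hom: "homeomorphism X Y \<phi> \<psi>"
    and orb: "\<And>x. x \<in> X \<Longrightarrow> {\<phi> (shift_pow n x) | n. True} = {shift_pow n (\<phi> x) | n. True}"
  defines "N \<equiv> distr M (restrict_space borel Y) \<phi>"
  shows "invariant_prob Y N"
    and "\<And>A. A \<in> sets N \<Longrightarrow> measure N A = measure M (\<phi> -` A \<inter> X)"
proof -
  interpret prob_space M using M by (simp add: invariant_prob_def)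
  have sp: "space M = X" by (rule space_invariant_prob[OF M])
  have sM: "sets M = sets (restrict_space borel X)" using M by (simp add: invariant_prob_def)
  let ?RX = "restrict_space borel X" and ?RY = "restrict_space borel Y"
  have cont: "continuous_on X \<phi>" "continuous_on Y \<psi>" and im: "\<phi> ` X = Y" "\<psi> ` Y = X"
    and inv: "\<And>x. x \<in> X \<Longrightarrow> \<psi> (\<phi> x) = x" "\<And>y. y \<in> Y \<Longrightarrow> \<phi> (\<psi> y) = y"
    using hom by (auto simp: homeomorphism_def)
  have phi_RX: "\<phi> \<in> measurable ?RX ?RY"
    by (rule measurable_restrict_space2[OF _ borel_measurable_continuous_on_restrict[OF cont(1)]])
      (use im in \<open>auto simp: space_restrict_space\<close>)
  then have phi: "\<phi> \<in> measurable M ?RY" using measurable_cong_sets[OF sM refl] by blast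
  have psi: "\<psi> \<in> measurable ?RY ?RX"
    by (rule measurable_restrict_space2[OF _ borel_measurable_continuous_on_restrict[OF cont(2)]])
      (use im in \<open>auto simp: space_restrict_space\<close>)
  show meas: "measure N A = measure M (\<phi> -` A \<inter> X)" if "A \<in> sets N" for A
    using that phi by (simp add: N_def measure_distr sp)
  define g where "g = (\<lambda>x. \<psi> (shift_pow 1 (\<phi> x)))"
  have g_RX: "g \<in> measurable ?RX ?RX"
    unfolding g_def
    by (intro measurable_compose[OF _ psi] measurable_compose[OF phi_RX] shift_pow_measurable[OF Y] refl)
  have gM: "g \<in> measurable M M" using g_RX measurable_cong_sets[OF sM sM] by blast
  have Ysh: "shift_pow k y \<in> Y" if "y \<in> Y" for y k using subshift_shift_pow[OF Y that] .
  have phiX: "\<phi> x \<in> Y" if "x \<in> X" for x using im(1) that by blast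
  have psiY: "\<psi> y \<in> X" if "y \<in> Y" for y using im(2) that by blast
  have phig: "\<phi> (g x) = shift_pow 1 (\<phi> x)" if "x \<in> X" for x
    unfolding g_def by (intro inv(2) Ysh phiX that)
  have gX: "g x \<in> X" if "x \<in> X" for x
    unfolding g_def by (intro psiY Ysh phiX that)
  have bij: "bij_betw g X X"
  proof (rule bij_betwI[where g = "\<lambda>x. \<psi> (shift_pow (- 1) (\<phi> x))"])
    show "g \<in> X \<rightarrow> X" "(\<lambda>x. \<psi> (shift_pow (- 1) (\<phi> x))) \<in> X \<rightarrow> X"
      by (auto intro: gX psiY Ysh phiX)
    show "\<psi> (shift_pow (- 1) (\<phi> (g x))) = x" if "x \<in> X" for x
      using phig[OF that] inv that by (simp add: shift_pow_add[symmetric])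
    show "g (\<psi> (shift_pow (- 1) (\<phi> x))) = x" if "x \<in> X" for x
    proof -
      have "\<phi> (\<psi> (shift_pow (- 1) (\<phi> x))) = shift_pow (- 1) (\<phi> x)"
        by (intro inv(2) Ysh phiX that)
      then show ?thesis using inv that by (simp add: g_def shift_pow_add[symmetric])
    qed
  qed
  have orbg: "\<exists>n. g x = shift_pow n x" if "x \<in> X" for x
  proof -
    have "shift_pow 1 (\<phi> x) \<in> {\<phi> (shift_pow n x) | n. True}" unfolding orb[OF that] by blast
    then obtain n where "shift_pow 1 (\<phi> x) = \<phi> (shift_pow n x)" by blast
    then show ?thesis using inv(1)[OF subshift_shift_pow[OF X that]] by (auto simp: g_def)
  qed
  show "invariant_prob Y N"
    unfolding invariant_prob_def
  proof (intro conjI ballI)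
    show "sets N = sets ?RY" by (simp add: N_def)
    show "prob_space N" unfolding N_def by (rule prob_space_distr[OF phi])
    fix A assume "A \<in> sets N"
    then have A: "A \<in> sets ?RY" by (simp add: N_def)
    have spN: "space N = Y" by (simp add: N_def space_restrict_space)
    have B: "left_shift -` A \<inter> Y \<in> sets ?RY"
      using measurable_sets[OF shift_pow_measurable[OF Y refl, of 1] A] by (simp add: shift_pow_1 space_restrict_space)
    have pA: "\<phi> -` A \<inter> X \<in> sets M" using measurable_sets[OF phi A] sp by simp
    have "emeasure N (left_shift -` A \<inter> space N) = emeasure M (\<phi> -` (left_shift -` A \<inter> Y) \<inter> X)"
      unfolding spN unfolding N_def using emeasure_distr[OF phi B] sp by simp
    also have "\<phi> -` (left_shift -` A \<inter> Y) \<inter> X = g -` (\<phi> -` A \<inter> X) \<inter> X"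
      using phig gX im by (auto simp: shift_pow_1)
    also have "emeasure M \<dots> = emeasure M (\<phi> -` A \<inter> X)"
      by (rule orbit_bijection_preserves_invariant_prob[OF X M gM bij orbg pA])
    also have "\<dots> = emeasure N A" unfolding N_def using emeasure_distr[OF phi A] sp by simp
    finally show "emeasure N (left_shift -` A \<inter> space N) = emeasure N A" .
  qed
qed

text \<open>
  By compactness a clopen set is a finite union of cylinders, relative to \<open>X\<close>.
\<close>

lemma countable_clopen:
  fixes X :: "(int \<Rightarrow> int) set"
  assumes X: "compact X"
  shows "countable {C. openin (top_of_set X) C \<and> closedin (top_of_set X) C}"
proof -
  have "C \<in> (\<lambda>\<D>. X \<inter> \<Union>\<D>) ` {\<D>. finite \<D> \<and> \<D> \<subseteq> cylinders}"
    if C: "openin (top_of_set X) C" "closedin (top_of_set X) C" for C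
  proof -
    obtain G where G: "open G" "C = X \<inter> G" using C(1) by (auto simp: openin_open)
    have c: "compact C" using C(2) X by (rule closedin_compact[rotated])
    have "C \<subseteq> \<Union>{D \<in> cylinders. D \<subseteq> G}" using open_eq_Union_cylinders[OF G(1)] G(2) by blast
    then obtain \<D> where "\<D> \<subseteq> {D \<in> cylinders. D \<subseteq> G}" "finite \<D>" "C \<subseteq> \<Union>\<D>"
    proof (rule compactE[OF c])
      show "open D" if "D \<in> {D \<in> cylinders. D \<subseteq> G}" for D
        using that open_cylinders by blast
    qed
    then have "finite \<D> \<and> \<D> \<subseteq> cylinders" "C = X \<inter> \<Union>\<D>" using G(2) by blast+
    then show ?thesis by (intro image_eqI[of C _ \<D>]) (simp_all only: mem_Collect_eq)
  qed
  then have "{C. openin (top_of_set X) C \<and> closedin (top_of_set X) C}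
      \<subseteq> (\<lambda>\<D>. X \<inter> \<Union>\<D>) ` {\<D>. finite \<D> \<and> \<D> \<subseteq> cylinders}"
    by blast
  moreover have "countable {\<D>. finite \<D> \<and> \<D> \<subseteq> cylinders}"
    by (rule countable_Collect_finite_subset[OF countable_cylinders])
  ultimately show ?thesis by (rule countable_subset[OF _ countable_image])
qed

text \<open>
  The invariant of orbit equivalence that carries the proof: pulling back the cylinder of a letter by
  the homeomorphism gives a clopen subset of \<open>X\<close>, and these have countably many measures in all.
\<close>

lemma orbit_equivalent_letter_measures:
  assumes X: "subshift X" and M: "invariant_prob X M"
  obtains S :: "real set" where "countable S"
    "\<And>Y. subshift Y \<Longrightarrow> orbit_equivalent X Y \<Longrightarrow>
      \<exists>N. invariant_prob Y N \<and> (\<forall>a. measure N {y \<in> Y. y 0 = a} \<in> S)"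
proof
  let ?S = "measure M ` {C. openin (top_of_set X) C \<and> closedin (top_of_set X) C}"
  show "countable ?S" using X by (intro countable_image countable_clopen) (simp add: subshift_def)
  fix Y assume Y: "subshift Y" and "orbit_equivalent X Y"
  then obtain \<phi> \<psi> where hom: "homeomorphism X Y \<phi> \<psi>"
    and orb: "\<And>x. x \<in> X \<Longrightarrow> {\<phi> (shift_pow n x) | n. True} = {shift_pow n (\<phi> x) | n. True}"
    unfolding orbit_equivalent_def by blast
  let ?N = "distr M (restrict_space borel Y) \<phi>"
  note N = orbit_equivalence_transports_invariant_prob[OF X Y M hom orb]
  have cont: "continuous_on X \<phi>" "\<phi> ` X = Y" using hom by (auto simp: homeomorphism_def)
  have cl: "closed {y :: int \<Rightarrow> int. y 0 = a}" "open {y :: int \<Rightarrow> int. y 0 = a}" for a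
    using closed_word[of 0 "Suc 0" "{[a]}"] open_word[of 0 "Suc 0" "{[a]}"] by (auto simp: word_1)
  have "measure ?N {y \<in> Y. y 0 = a} \<in> ?S" for a
  proof -
    have "{y \<in> Y. y 0 = a} \<in> sets ?N" by (rule letter_set_in_sets) simp
    then have "measure ?N {y \<in> Y. y 0 = a} = measure M (\<phi> -` {y \<in> Y. y 0 = a} \<inter> X)"
      using N(2) by blast
    moreover have "\<phi> -` {y \<in> Y. y 0 = a} \<inter> X = X \<inter> \<phi> -` {y. y 0 = a}" using cont(2) by auto
    moreover have "openin (top_of_set X) (X \<inter> \<phi> -` {y. y 0 = a})"
      using continuous_openin_preimage_gen[OF cont(1) cl(2)] .
    moreover have "closedin (top_of_set X) (X \<inter> \<phi> -` {y. y 0 = a})"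
      using continuous_closedin_preimage[OF cont(1) cl(1)] .
    ultimately show ?thesis by simp
  qed
  then show "\<exists>N. invariant_prob Y N \<and> (\<forall>a. measure N {y \<in> Y. y 0 = a} \<in> ?S)"
    using N(1) by blast
qed

section \<open>Existence of invariant measures\<close>

text \<open>
  This is used to pass conditions on the terms of a sequence to its cluster points, in spaces where
  no convergent subsequence need exist.
\<close>

lemma cluster_point_in_closed:
  assumes p: "inf (nhds p) F \<noteq> bot" and C: "closed C" "eventually (\<lambda>x. x \<in> C) F"
  shows "p \<in> C"
proof (rule ccontr)
  assume "p \<notin> C"
  then have "eventually (\<lambda>x. x \<in> - C) (nhds p)"
    using C(1) by (intro eventually_nhds_in_open) auto
  then have "eventually (\<lambda>x. False) (inf (nhds p) F)"
    using C(2) unfolding eventually_inf by blast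
  then show False using p by (simp add: trivial_limit_def)
qed

text \<open>
  The mean is a cluster point of the empirical averages along the orbit of \<open>x\<close>, taken in the compact
  product of one unit interval for each subset of the space. Averages of an orbit change by at most
  \<open>1 / (n + 1)\<close> when the set is replaced by its preimage, so that every cluster point is invariant.
\<close>

lemma invariant_mean_exists:
  fixes T :: "'a \<Rightarrow> 'a" and x :: 'a
  assumes inX: "\<And>i. (T ^^ i) x \<in> X"
  obtains m :: "'a set \<Rightarrow> real" where "\<And>A. 0 \<le> m A" "m X = 1"
    "\<And>A B. A \<inter> B = {} \<Longrightarrow> m (A \<union> B) = m A + m B" "\<And>A. m (T -` A) = m A"
proof -
  define f where "f n A = (\<Sum>i<Suc n. indicat_real A ((T ^^ i) x)) / real (Suc n)" for n A
  have f01: "0 \<le> f n A" "f n A \<le> 1" for n A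
  proof -
    show "0 \<le> f n A" unfolding f_def by (intro divide_nonneg_nonneg sum_nonneg) auto
    have "(\<Sum>i<Suc n. indicat_real A ((T ^^ i) x)) \<le> (\<Sum>i<Suc n. 1)"
      by (intro sum_mono) (auto simp: indicator_def)
    then show "f n A \<le> 1" unfolding f_def by (simp add: field_simps)
  qed
  have "compactin (product_topology (\<lambda>_::'a set. euclidean :: real topology) UNIV) (\<Pi>\<^sub>E A\<in>UNIV. {0..1})"
    by (simp add: compactin_PiE)
  then have "compact ((\<Pi>\<^sub>E A\<in>UNIV. {0..1}) :: ('a set \<Rightarrow> real) set)"
    by (simp add: euclidean_product_topology)
  moreover have "filtermap f sequentially \<noteq> bot" by (simp add: filtermap_bot_iff)
  moreover have "eventually (\<lambda>p. p \<in> (\<Pi>\<^sub>E A\<in>UNIV. {0..1})) (filtermap f sequentially)"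
    using f01 by (simp add: eventually_filtermap PiE_UNIV_domain)
  ultimately obtain m where "m \<in> (\<Pi>\<^sub>E A\<in>UNIV. {0..1})" and m: "inf (nhds m) (filtermap f sequentially) \<noteq> bot"
    unfolding compact_filter by blast
  note closed_prop = cluster_point_in_closed[OF m, unfolded eventually_filtermap]
  have coord: "continuous_on UNIV (\<lambda>p :: 'a set \<Rightarrow> real. p A)" for A
    by (rule continuous_on_product_coordinates)
  show ?thesis
  proof (rule that[of m])
    fix A B :: "'a set"
    have "m \<in> {p. 0 \<le> p A}"
      by (rule closed_prop) (use f01 in \<open>auto intro!: closed_Collect_le coord continuous_intros\<close>)
    then show "0 \<le> m A" by simp
    have "m \<in> {p. p X = 1}"
    proof (rule closed_prop)
      show "closed {p :: 'a set \<Rightarrow> real. p X = 1}" by (intro closed_Collect_eq coord continuous_intros)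
    qed (use inX in \<open>auto simp: f_def field_simps\<close>)
    then show "m X = 1" by simp
    show "m (A \<union> B) = m A + m B" if "A \<inter> B = {}"
    proof -
      have "m \<in> {p. p (A \<union> B) = p A + p B}"
      proof (rule closed_prop)
        show "closed {p :: 'a set \<Rightarrow> real. p (A \<union> B) = p A + p B}"
          by (intro closed_Collect_eq coord continuous_intros)
        have "indicat_real (A \<union> B) y = indicat_real A y + indicat_real B y" for y
          using that by (auto simp: indicator_def)
        then show "\<forall>\<^sub>F n in sequentially. f n \<in> {p. p (A \<union> B) = p A + p B}"
          by (simp add: f_def sum.distrib add_divide_distrib)
      qed
      then show ?thesis by simp
    qed
    have step: "\<bar>f n (T -` A) - f n A\<bar> \<le> 1 / real (Suc n)" for n
    proof -
      let ?g = "\<lambda>i. indicat_real A ((T ^^ i) x)"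
      have "f n (T -` A) - f n A = (\<Sum>i<Suc n. ?g (Suc i) - ?g i) / real (Suc n)"
        unfolding f_def sum_subtractf diff_divide_distrib by (simp add: indicator_def)
      also have "\<dots> = (?g (Suc n) - ?g 0) / real (Suc n)"
        using sum_lessThan_telescope[of ?g "Suc n"] by (simp only:)
      finally show ?thesis
        by (simp add: abs_divide divide_right_mono indicator_def)
    qed
    have "\<bar>m (T -` A) - m A\<bar> \<le> e" if e: "e > 0" for e
    proof -
      have "m \<in> {p. \<bar>p (T -` A) - p A\<bar> \<le> e}"
      proof (rule closed_prop)
        show "closed {p :: 'a set \<Rightarrow> real. \<bar>p (T -` A) - p A\<bar> \<le> e}"
          by (intro closed_Collect_le coord continuous_intros)
        obtain k where k: "inverse (real (Suc k)) < e" using reals_Archimedean[OF e] by blast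
        have "\<bar>f n (T -` A) - f n A\<bar> \<le> e" if "n \<ge> k" for n
        proof -
          have "1 / real (Suc n) \<le> inverse (real (Suc k))"
            using that by (simp add: field_simps)
          then show ?thesis using step[of n] k by linarith
        qed
        then show "\<forall>\<^sub>F n in sequentially. f n \<in> {p. \<bar>p (T -` A) - p A\<bar> \<le> e}"
          by (auto intro: eventually_sequentiallyI)
      qed
      then show ?thesis by simp
    qed
    then have "\<bar>m (T -` A) - m A\<bar> \<le> 0" by (rule field_le_epsilon) simp
    then show "m (T -` A) = m A" by simp
  qed
qed

text \<open>
  Cylinders are clopen, and generate the Borel sets.
\<close>

lemma sets_restrict_borel_eq_clopen:
  fixes X :: "(int \<Rightarrow> int) set"
  shows "sets (restrict_space borel X) =
    sigma_sets X {C. openin (top_of_set X) C \<and> closedin (top_of_set X) C}" (is "_ = sigma_sets X ?\<A>")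
proof
  have sub: "?\<A> \<subseteq> Pow X" by (auto dest: openin_imp_subset)
  interpret sigma_algebra X "sigma_sets X ?\<A>" by (rule sigma_algebra_sigma_sets[OF sub])
  have "X \<inter> B \<in> sigma_sets X ?\<A>" if "B \<in> sigma_sets UNIV cylinders" for B
    using that
  proof induction
    case (Basic B)
    then have "open B" "closed B"
      by (auto simp: cylinders_def open_cylinder intro: closed_word[of _ _ "{w}" for w, simplified])
    then show ?case by (intro sigma_sets.Basic CollectI conjI openin_open_Int closedin_closed_Int)
  next
    case (Compl B)
    have "X \<inter> (UNIV - B) = X - X \<inter> B" by blast
    then show ?case using Compl.IH by (metis sigma_sets.Compl)
  next
    case (Union B)
    then have "(\<Union>i. X \<inter> B i) \<in> sigma_sets X ?\<A>" by (intro sigma_sets.Union)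
    then show ?case by simp
  qed (simp add: sigma_sets.Empty)
  then show "sets (restrict_space borel X) \<subseteq> sigma_sets X ?\<A>"
    by (auto simp: sets_restrict_space sets_borel_eq_cylinders)
  have "?\<A> \<subseteq> sets (restrict_space borel X)"
  proof
    fix C assume "C \<in> ?\<A>"
    then have "openin (top_of_set X) C" by blast
    then obtain G where "open G" "C = X \<inter> G" by (meson openin_open)
    then show "C \<in> sets (restrict_space borel X)"
      unfolding sets_restrict_space by (intro image_eqI[of C _ G] borel_open)
  qed
  then show "sigma_sets X ?\<A> \<subseteq> sets (restrict_space borel X)"
    using sets.sigma_sets_subset[of ?\<A> "restrict_space borel X"] by (simp add: space_restrict_space)
qed

lemma decseq_clopen_empty:
  assumes X: "compact X" and A: "\<And>n. closedin (top_of_set X) (A n)"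
    and dec: "decseq A" and empty: "(\<Inter>n. A n) = {}"
  obtains n :: nat where "\<And>k. n \<le> k \<Longrightarrow> A k = {}"
proof -
  have "\<forall>n. \<exists>G. open G \<and> X - A n = X \<inter> G"
    using A by (metis openin_diff openin_open openin_topspace topspace_euclidean_subtopology)
  then obtain G where G: "\<And>n. open (G n)" "\<And>n. X - A n = X \<inter> G n" by metis
  have AX: "A n \<subseteq> X" for n using closedin_subset[OF A] by simp
  have "X \<subseteq> (\<Union>n\<in>UNIV. G n)"
  proof
    fix y assume "y \<in> X"
    moreover obtain n where "y \<notin> A n" using empty by blast
    ultimately have "y \<in> X \<inter> G n" unfolding G(2)[symmetric] by blast
    then show "y \<in> (\<Union>n\<in>UNIV. G n)" by blast
  qed
  then obtain F where F: "finite F" "X \<subseteq> (\<Union>n\<in>F. G n)"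
    using compactE_image[OF X, of UNIV G] G(1) by metis
  show ?thesis
  proof (rule that[of "Max (insert 0 F)"])
    fix k assume k: "Max (insert 0 F) \<le> k"
    show "A k = {}"
    proof (rule ccontr)
      assume "A k \<noteq> {}"
      then obtain y where y: "y \<in> A k" by blast
      then obtain n where n: "n \<in> F" "y \<in> G n" using F(2) AX by blast
      then have "n \<le> k" using k F(1) Max_ge[of "insert 0 F" n] by simp
      then have "y \<in> A n" using y dec by (auto simp: decseq_def)
      then show False using G(2)[of n] n y AX by blast
    qed
  qed
qed

text \<open>
  The Krylov-Bogoliubov theorem for subshifts. The clopen subsets form an algebra that generates the
  Borel sets, and by compactness a decreasing sequence of clopen sets with empty intersection is
  eventually empty. So the restriction of an invariant mean to this algebra extends to a
  measure by the theorem of Caratheodory; invariance passes to the extension by uniqueness.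
\<close>

lemma invariant_prob_exists:
  assumes X: "subshift X"
  obtains M where "invariant_prob X M"
proof -
  obtain x0 where x0: "x0 \<in> X" using X by (auto simp: subshift_def)
  have comp: "compact X" and im: "left_shift ` X = X" using X by (auto simp: subshift_def)
  have orb: "(left_shift ^^ i) x0 \<in> X" for i
    by (induction i) (use x0 im in auto)
  obtain m :: "(int \<Rightarrow> int) set \<Rightarrow> real" where m0: "\<And>A. 0 \<le> m A" and mX: "m X = 1"
    and madd: "\<And>A B. A \<inter> B = {} \<Longrightarrow> m (A \<union> B) = m A + m B"
    and minv: "\<And>A. m (left_shift -` A) = m A"
    using invariant_mean_exists[of left_shift x0 X] orb by blast
  have m_empty: "m {} = 0" using madd[of "{}" "{}"] by simp
  let ?\<A> = "{C. openin (top_of_set X) C \<and> closedin (top_of_set X) C}"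
  have sub: "?\<A> \<subseteq> Pow X" by (auto dest: openin_imp_subset)
  have alg: "algebra X ?\<A>"
    unfolding algebra_iff_Un using sub by (auto intro: openin_diff closedin_diff)
  interpret A: algebra X ?\<A> by (rule alg)
  have "\<exists>\<mu>::(int \<Rightarrow> int) set \<Rightarrow> ennreal. (\<forall>s\<in>?\<A>. \<mu> s = ennreal (m s)) \<and> measure_space X (sigma_sets X ?\<A>) \<mu>"
  proof (rule A.caratheodory_empty_continuous)
    show "positive ?\<A> (\<lambda>s. ennreal (m s))" by (simp add: positive_def m_empty)
    show "additive ?\<A> (\<lambda>s. ennreal (m s))"
      by (simp add: additive_def madd m0 ennreal_plus)
    show "ennreal (m A) \<noteq> \<infinity>" for A by simp
    fix A :: "nat \<Rightarrow> _" assume A: "range A \<subseteq> ?\<A>" "decseq A" "(\<Inter>i. A i) = {}"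
    then obtain n where "\<And>k. n \<le> k \<Longrightarrow> A k = {}"
      using decseq_clopen_empty[OF comp, of A] by blast
    then have "\<forall>\<^sub>F k in sequentially. ennreal (m (A k)) = 0"
      by (intro eventually_sequentiallyI[of n]) (simp add: m_empty)
    then show "(\<lambda>i. ennreal (m (A i))) \<longlonglongrightarrow> 0" by (rule tendsto_eventually)
  qed
  then obtain \<mu> :: "(int \<Rightarrow> int) set \<Rightarrow> ennreal" where \<mu>: "\<And>s. s \<in> ?\<A> \<Longrightarrow> \<mu> s = ennreal (m s)"
    and ms: "measure_space X (sigma_sets X ?\<A>) \<mu>" by blast
  define M where "M = measure_of X (sigma_sets X ?\<A>) \<mu>"
  have "sigma_algebra X (sigma_sets X ?\<A>)" using ms by (simp add: measure_space_def)
  then have sets_M: "sets M = sigma_sets X ?\<A>" and sp: "space M = X"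
    using sub by (simp_all add: M_def sigma_algebra.sets_measure_of_eq sigma_algebra.space_measure_of_eq)
  have em: "emeasure M A = ennreal (m A)" if "A \<in> ?\<A>" for A
    using that ms \<mu> emeasure_measure_of_sigma[of X "sigma_sets X ?\<A>" \<mu> A]
    by (simp add: M_def measure_space_def sigma_sets.Basic)
  have sM: "sets M = sets (restrict_space borel X)"
    by (simp add: sets_M sets_restrict_borel_eq_clopen)
  have XA: "X \<in> ?\<A>" by auto
  have prob: "prob_space M" by (rule prob_spaceI) (use em[OF XA] mX sp in simp)
  have meas: "left_shift \<in> measurable M M"
    using shift_pow_measurable[OF X sM, of 1] by (simp add: shift_pow_1)
  have pre: "left_shift -` A \<inter> X = left_shift -` A" if "A \<subseteq> X" for A
  proof -
    have "y \<in> X" if "left_shift y \<in> X" for y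
      using subshift_shift_pow[OF X that, of "-1"] by (simp add: shift_pow_add[symmetric] flip: shift_pow_1)
    then show ?thesis using that by blast
  qed
  have "distr M M left_shift = M"
  proof (rule measure_eqI_generator_eq[where \<Omega> = X and E = ?\<A> and A = "\<lambda>_. X"])
    show "Int_stable ?\<A>" by (auto simp: Int_stable_def)
    fix A assume A: "A \<in> ?\<A>"
    have cont: "continuous_on X left_shift"
      using continuous_on_subset[OF continuous_shift_pow[of 1] subset_UNIV] by (simp add: shift_pow_1)
    have "left_shift \<in> X \<rightarrow> X" using im by auto
    then have "X \<inter> left_shift -` A \<in> ?\<A>"
      using A continuous_openin_preimage[OF cont] continuous_closedin_preimage_gen[OF cont] by auto
    then have "emeasure M (left_shift -` A \<inter> X) = ennreal (m A)"
      using em[of "X \<inter> left_shift -` A"] pre[of A] minv A sub by (auto simp: Int_commute)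
    then show "emeasure (distr M M left_shift) A = emeasure M A"
      using A em[OF A] emeasure_distr[OF meas, of A] by (simp add: sp sets_M sigma_sets.Basic)
  next
    show "emeasure (distr M M left_shift) X \<noteq> \<infinity>"
      using prob_space.emeasure_space_1[OF prob_space.prob_space_distr[OF prob meas]] by (simp add: sp)
  qed (use sub sets_M XA in auto)
  then have "emeasure M (left_shift -` A \<inter> space M) = emeasure M A" if "A \<in> sets M" for A
    using emeasure_distr[OF meas that] by simp
  then have "invariant_prob X M" using sM prob by (simp add: invariant_prob_def)
  then show ?thesis by (rule that)
qed

section \<open>Completeness and category\<close>

text \<open>
  Along a Cauchy sequence the language of each length is eventually constant. The limit consists of
  the sequences all of whose words are in these eventual languages. Compactness shows that
  each such word \<open>w\<close> really occurs in the limit: choose points of the given subshifts that contain \<open>w\<close> at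
  the origin, and take a cluster point.
\<close>

lemma mcomplete_subshifts: "subshifts.mcomplete"
  unfolding subshifts.mcomplete_def
proof (intro allI impI)
  fix \<sigma> assume C: "subshifts.MCauchy \<sigma>"
  have sub: "subshift (\<sigma> k)" for k using C by (auto simp: subshifts.MCauchy_def)
  have "\<exists>K. \<forall>k\<ge>K. language n (\<sigma> k) = language n (\<sigma> K)" for n
  proof -
    obtain K where "\<forall>k l. K \<le> k \<longrightarrow> K \<le> l \<longrightarrow> subshift_dist (\<sigma> k) (\<sigma> l) < 1 / 2 ^ n"
      using C unfolding subshifts.MCauchy_def by (meson zero_less_divide_1_iff zero_less_numeral zero_less_power)
    then show ?thesis using subshift_dist_less_iff[OF sub sub] by blast
  qed
  then obtain K where K: "\<And>n k. K n \<le> k \<Longrightarrow> language n (\<sigma> k) = language n (\<sigma> (K n))" by metis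
  define \<Lambda> where "\<Lambda> = (\<Union>n. language n (\<sigma> (K n)))"
  have L: "w \<in> \<Lambda> \<longleftrightarrow> w \<in> language (length w) (\<sigma> (K (length w)))" for w
    by (auto simp: \<Lambda>_def dest: length_language)
  let ?Y = "sequences_with \<Lambda>"
  define A where "A = {c. [c] \<in> \<Lambda>}"
  have "A \<subseteq> hd ` language 1 (\<sigma> (K 1))" by (force simp: A_def L)
  then have finA: "finite A" using finite_language[OF sub] finite_subset by blast
  have ext: "\<exists>y\<in>?Y. word y 0 n = w" if w: "w \<in> language n (\<sigma> (K n))" for w n
  proof -
    have "\<exists>x. K n \<le> k \<longrightarrow> x \<in> \<sigma> k \<and> word x 0 n = w" for k
    proof (cases "K n \<le> k")
      case True
      have "w \<in> language n (\<sigma> k)" unfolding K[OF True] by (rule w)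
      then obtain x i where "x \<in> \<sigma> k" "word x i n = w" by (auto simp: language_eq)
      then show ?thesis
        using subshift_shift_pow[OF sub, of x k i] by (intro exI[of _ "shift_pow i x"]) simp
    qed simp
    then obtain x where x: "\<And>k. K n \<le> k \<Longrightarrow> x k \<in> \<sigma> k" "\<And>k. K n \<le> k \<Longrightarrow> word (x k) 0 n = w"
      by metis
    have ev: "\<forall>\<^sub>F k in sequentially. word (x k) i l \<in> \<Lambda>" for i l
    proof (rule eventually_sequentiallyI[of "max (K n) (K l)"])
      fix k assume "max (K n) (K l) \<le> k"
      then show "word (x k) i l \<in> \<Lambda>"
        using word_in_language[OF x(1), of k i l] K[of l k] by (simp add: L)
    qed
    have "\<forall>\<^sub>F k in sequentially. x k \<in> {y. \<forall>i. y i \<in> A}"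
    proof (rule eventually_sequentiallyI[of "max (K n) (K 1)"])
      fix k assume "max (K n) (K 1) \<le> k"
      then have "word (x k) i 1 \<in> \<Lambda>" for i
        using word_in_language[OF x(1), of k i 1] K[of 1 k] by (simp add: L)
      then show "x k \<in> {y. \<forall>i. y i \<in> A}" by (simp add: A_def word_1)
    qed
    then have "\<forall>\<^sub>F y in filtermap x sequentially. y \<in> {y. \<forall>i. y i \<in> A}"
      by (simp only: eventually_filtermap)
    moreover have "filtermap x sequentially \<noteq> bot" by (simp add: filtermap_bot_iff)
    ultimately obtain y where y: "inf (nhds y) (filtermap x sequentially) \<noteq> bot"
      using compact_sequences_over[OF finA] unfolding compact_filter by blast
    note closed_prop = cluster_point_in_closed[OF y, unfolded eventually_filtermap]
    have "y \<in> {y. word y i l \<in> \<Lambda>}" for i l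
      by (rule closed_prop[OF closed_word]) (use ev in simp)
    then have "y \<in> ?Y" by (simp add: sequences_with_def)
    moreover have "y \<in> {y. word y 0 n \<in> {w}}"
      by (rule closed_prop[OF closed_word]) (use x(2) in \<open>auto intro: eventually_sequentiallyI[of "K n"]\<close>)
    ultimately show ?thesis by blast
  qed
  have lang: "language n ?Y = language n (\<sigma> (K n))" for n
  proof (intro equalityI subsetI)
    fix w assume w: "w \<in> language n ?Y"
    then have "w \<in> \<Lambda>" by (auto simp: language_eq sequences_with_def)
    then show "w \<in> language n (\<sigma> (K n))" using L length_language[OF w] by simp
  next
    fix w assume "w \<in> language n (\<sigma> (K n))"
    then show "w \<in> language n ?Y" using ext word_in_language by blast
  qed
  have "?Y \<noteq> {}"
  proof -
    obtain z where "z \<in> \<sigma> (K 0)" using sub[of "K 0"] by (auto simp: subshift_def)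
    then show ?thesis using ext[OF word_in_language] by blast
  qed
  then have Y: "subshift ?Y" using finA by (intro subshift_sequences_with) (simp_all add: A_def)
  have "limitin subshifts.mtopology \<sigma> ?Y sequentially"
    unfolding subshifts.limit_metric_sequentially
  proof (intro conjI allI impI)
    fix e :: real assume "0 < e"
    then obtain n where n: "(1 / 2) ^ n < e" using real_arch_pow_inv[of e "1/2"] by auto
    show "\<exists>N. \<forall>k\<ge>N. \<sigma> k \<in> Collect subshift \<and> subshift_dist (\<sigma> k) ?Y < e"
    proof (intro exI[of _ "K n"] allI impI conjI)
      fix k assume k: "K n \<le> k"
      have "subshift_dist (\<sigma> k) ?Y < 1 / 2 ^ n"
        unfolding subshift_dist_less_iff[OF sub Y] lang by (rule K[OF k])
      then show "subshift_dist (\<sigma> k) ?Y < e" using n by (simp add: power_one_over)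
    qed (use sub in simp)
  qed (use Y in simp)
  then show "\<exists>x. limitin subshifts.mtopology \<sigma> x sequentially" by blast
qed

text \<open>
  Otherwise the dense open sets that define the residual set, together with the complements of the
  closures of the nowhere dense ones, would be countably many dense open sets with empty
  intersection, against the theorem of Baire.
\<close>

lemma meager_not_residual:
  assumes T: "completely_metrizable_space T" "topspace T \<noteq> {}" and A: "meager_in T A"
  shows "\<not> residual_in T A"
proof
  assume "residual_in T A"
  then obtain G where G: "G \<subseteq> A" "gdelta_in T G" "T closure_of G = topspace T"
    by (auto simp: residual_in_def)
  obtain \<U> where U: "countable \<U>" "\<And>U. U \<in> \<U> \<Longrightarrow> openin T U" "\<Inter>\<U> = G"
    using G(2) unfolding gdelta_in_alt intersection_of_def by blast
  obtain \<N> where N: "countable \<N>" "\<And>N. N \<in> \<N> \<Longrightarrow> nowhere_dense_in T N" "A = \<Union>\<N>"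
    using A unfolding meager_in_def by blast
  let ?\<G> = "\<U> \<union> (\<lambda>N. topspace T - T closure_of N) ` \<N>"
  have "T closure_of \<Inter>?\<G> = topspace T"
  proof (rule Baire_category)
    show "countable ?\<G>" using U(1) N(1) by simp
    fix S assume "S \<in> ?\<G>"
    then consider "S \<in> \<U>" | N where "N \<in> \<N>" "S = topspace T - T closure_of N" by blast
    then show "openin T S \<and> T closure_of S = topspace T"
    proof cases
      case 1
      then have "G \<subseteq> S" using U(3) by blast
      then have "topspace T \<subseteq> T closure_of S" using closure_of_mono[of G S T] G(3) by simp
      then show ?thesis using U(2)[OF 1] by (simp add: closure_of_subset_topspace subset_antisym)
    next
      case 2
      then show ?thesis using N(2)[OF 2(1)]
        by (simp add: nowhere_dense_in_def closure_of_complement openin_diff)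
    qed
  qed (use T in simp)
  then have "\<Inter>?\<G> \<noteq> {}" using T(2) by (metis closure_of_empty)
  then obtain p where p: "p \<in> \<Inter>?\<G>" by blast
  then have "p \<in> A" using U(3) G(1) by auto
  then obtain N where N': "N \<in> \<N>" "p \<in> N" using N(3) by blast
  then have "p \<in> T closure_of N" using N(2)[OF N'(1)] closure_of_subset[of N T] by (auto simp: nowhere_dense_in_def)
  then show False using p N'(1) by auto
qed

section \<open>Orbit equivalence classes\<close>

lemma infinite_tt_closure_subshift: "X \<in> infinite_tt_closure \<Longrightarrow> subshift X"
  unfolding infinite_tt_closure_def using closure_of_subset_topspace
  by (metis mem_Collect_eq subsetD subshifts.topspace_mtopology)

lemma infinite_tt_subset_closure: "infinite_tt \<subseteq> infinite_tt_closure"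
  unfolding infinite_tt_closure_def by (rule closure_of_subset) (auto simp: infinite_tt_def)

lemma topspace_infinite_tt_closure_topology [simp]:
  "topspace infinite_tt_closure_topology = infinite_tt_closure"
  unfolding infinite_tt_closure_topology_def using infinite_tt_closure_subshift by auto

lemma completely_metrizable_infinite_tt_closure:
  "completely_metrizable_space infinite_tt_closure_topology"
  unfolding infinite_tt_closure_topology_def infinite_tt_closure_def
  by (intro completely_metrizable_space_closedin closedin_closure_of
      subshifts.completely_metrizable_space_mtopology mcomplete_subshifts)

lemma open_contains_language_ball:
  assumes "openin subshifts.mtopology U" "Z \<in> U"
  obtains n where "\<And>Y. subshift Y \<Longrightarrow> language n Y = language n Z \<Longrightarrow> Y \<in> U"
proof -
  obtain r where r: "r > 0" "subshifts.mball Z r \<subseteq> U" and Z: "subshift Z"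
    using assms unfolding subshifts.openin_mtopology by blast
  obtain n where n: "(1 / 2) ^ n < r" using real_arch_pow_inv[of r "1/2"] r(1) by auto
  show ?thesis
  proof (rule that[of n])
    fix Y assume Y: "subshift Y" "language n Y = language n Z"
    then have "subshift_dist Z Y < 1 / 2 ^ n" using subshift_dist_less_iff[OF Z Y(1), of n] by simp
    then have "Y \<in> subshifts.mball Z r" using n Z Y by (simp add: power_one_over)
    then show "Y \<in> U" using r by blast
  qed
qed

text \<open>
  An open set in which these subshifts are dense contains an infinite totally transitive \<open>X\<close>, and
  the letter \<open>a\<close> occurs in it. A perturbation \<open>Z\<close> of \<open>X\<close> in the same open set has all frequencies of
  \<open>a\<close> in words of some length \<open>N\<close> on one side of \<open>s\<close>, with a gap. Subshifts with the same words of
  length \<open>N\<close> as \<open>Z\<close> then give the letter a measure different from \<open>s\<close>, although some of them should be in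
  the set. The condition that \<open>a\<close> occurs excludes the open set of subshifts without this letter, which all
  give it measure 0.
\<close>

lemma nowhere_dense_letter_measure:
  "nowhere_dense_in infinite_tt_closure_topology
    {Y \<in> infinite_tt_closure. [a] \<in> language 1 Y \<and>
      (\<exists>N. invariant_prob Y N \<and> measure N {y \<in> Y. y 0 = a} = s)}"
    (is "nowhere_dense_in ?T ?A")
  unfolding nowhere_dense_in_def
proof
  show "?A \<subseteq> topspace ?T" by auto
  show "?T interior_of (?T closure_of ?A) = {}"
  proof (rule ccontr)
    assume "?T interior_of (?T closure_of ?A) \<noteq> {}"
    moreover define V where "V = ?T interior_of (?T closure_of ?A)"
    ultimately have V: "openin ?T V" "V \<subseteq> ?T closure_of ?A" "V \<noteq> {}"
      unfolding V_def by (simp_all only: openin_interior_of interior_of_subset not_False_eq_True)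
    obtain U where U: "openin subshifts.mtopology U" "V = U \<inter> infinite_tt_closure"
      using V(1) by (auto simp: infinite_tt_closure_topology_def openin_subtopology)
    obtain X where X: "X \<in> infinite_tt" "X \<in> U"
    proof -
      obtain Y where "Y \<in> U" "Y \<in> infinite_tt_closure" using V(3) U(2) by blast
      then show ?thesis using U(1) that unfolding infinite_tt_closure_def by (metis in_closure_of)
    qed
    have meets: "\<exists>Y\<in>?A. language n Y = language n Z" if Z: "Z \<in> infinite_tt" "Z \<in> U" for Z n
    proof -
      have sZ: "subshift Z" using Z by (simp add: infinite_tt_def)
      have "Z \<in> V" using Z U infinite_tt_subset_closure by blast
      then have "Z \<in> ?T closure_of ?A" using V by blast
      moreover have "openin ?T (subshifts.mball Z (1 / 2 ^ n) \<inter> infinite_tt_closure)"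
        unfolding infinite_tt_closure_topology_def by (intro openin_subtopology_Int subshifts.openin_mball)
      moreover have "Z \<in> subshifts.mball Z (1 / 2 ^ n) \<inter> infinite_tt_closure"
        using Z sZ infinite_tt_subset_closure by auto
      ultimately obtain Y where Y: "Y \<in> ?A" "Y \<in> subshifts.mball Z (1 / 2 ^ n)"
        by (meson IntE in_closure_of)
      then have "language n Z = language n Y"
        using subshift_dist_less_iff[of Z Y n] by simp
      then show ?thesis using Y(1) by (intro bexI[of _ Y]) (rule sym)
    qed
    obtain n where n: "\<And>Y. subshift Y \<Longrightarrow> language n Y = language n X \<Longrightarrow> Y \<in> U"
      using open_contains_language_ball[OF U(1) X(2)] by blast
    have "[a] \<in> language 1 X" using meets[OF X, of 1] by auto
    then obtain Z N where Z: "Z \<in> infinite_tt" "language n Z = language n X"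
      and gap: "(\<forall>w\<in>language N Z. s * N + 1 \<le> count_list w a) \<or> (\<forall>w\<in>language N Z. count_list w a \<le> s * N - 1)"
      using letter_frequency_perturbation[OF X(1), of a n s] by blast
    have "Z \<in> U" using n Z by (simp add: infinite_tt_def)
    then obtain Y M where Y: "Y \<in> infinite_tt_closure" "language N Y = language N Z"
      and M: "invariant_prob Y M" "measure M {y \<in> Y. y 0 = a} = s"
      using meets[OF Z(1), of N] by blast
    have sY: "subshift Y" using infinite_tt_closure_subshift Y by blast
    show False
      using gap letter_measure_bounds(1)[OF sY M(1), where N = N and a = a and t = "s * real N + 1"]
        letter_measure_bounds(2)[OF sY M(1), where N = N and a = a and t = "s * real N - 1"]
      unfolding Y(2) M(2) by (auto simp: mult.commute)
  qed
qed

lemma nowhere_dense_in_subset: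
  assumes "nowhere_dense_in T B" "A \<subseteq> B"
  shows "nowhere_dense_in T A"
proof -
  have "T interior_of (T closure_of A) \<subseteq> T interior_of (T closure_of B)"
    by (intro interior_of_mono closure_of_mono assms(2))
  then show ?thesis using assms unfolding nowhere_dense_in_def by blast
qed

text \<open>
  Each member of the class has some letter, and its measure is one of countably many numbers. So
  the class is covered by the nowhere dense sets of the preceding lemma, for all letters and all of
  these numbers.
\<close>

lemma meager_orbit_equivalence_class:
  assumes "X \<in> infinite_tt_closure"
  shows "meager_in infinite_tt_closure_topology (orbit_equivalence_class X)"
proof -
  have X: "subshift X" using assms by (rule infinite_tt_closure_subshift)
  obtain M where M: "invariant_prob X M" using invariant_prob_exists[OF X] .
  obtain S :: "real set" where S: "countable S" "\<And>Y. subshift Y \<Longrightarrow> orbit_equivalent X Y \<Longrightarrow>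
      \<exists>N. invariant_prob Y N \<and> (\<forall>a. measure N {y \<in> Y. y 0 = a} \<in> S)"
    by (rule orbit_equivalent_letter_measures[OF X M]) blast
  define \<N> where "\<N> a s = {Y \<in> infinite_tt_closure. [a] \<in> language 1 Y \<and>
      (\<exists>N. invariant_prob Y N \<and> measure N {y \<in> Y. y 0 = a} = s)}" for a :: int and s :: real
  let ?\<M> = "(\<lambda>(a, s). \<N> a s \<inter> orbit_equivalence_class X) ` (UNIV \<times> S)"
  have "countable ?\<M>" using S(1) by (intro countable_image countable_SIGMA) auto
  moreover have "nowhere_dense_in infinite_tt_closure_topology B" if B: "B \<in> ?\<M>" for B
  proof -
    obtain a s where "B = \<N> a s \<inter> orbit_equivalence_class X" using B by auto
    then have "B \<subseteq> \<N> a s" by simp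
    then show ?thesis unfolding \<N>_def by (rule nowhere_dense_in_subset[OF nowhere_dense_letter_measure])
  qed
  moreover have "orbit_equivalence_class X = \<Union>?\<M>"
  proof
    show "orbit_equivalence_class X \<subseteq> \<Union>?\<M>"
    proof
      fix Y assume Y: "Y \<in> orbit_equivalence_class X"
      then have Y': "Y \<in> infinite_tt_closure" "orbit_equivalent X Y"
        by (auto simp: orbit_equivalence_class_def)
      have sY: "subshift Y" using Y'(1) by (rule infinite_tt_closure_subshift)
      obtain y where "y \<in> Y" using sY by (auto simp: subshift_def)
      then have a: "[y 0] \<in> language 1 Y" using word_in_language[of y Y 0 1] by (simp add: word_1)
      obtain N where "invariant_prob Y N" "measure N {z \<in> Y. z 0 = y 0} \<in> S"
        using S(2)[OF sY Y'(2)] by blast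
      then have "Y \<in> \<N> (y 0) (measure N {z \<in> Y. z 0 = y 0})" using Y'(1) a by (auto simp: \<N>_def)
      then show "Y \<in> \<Union>?\<M>" using Y \<open>measure N {z \<in> Y. z 0 = y 0} \<in> S\<close> by blast
    qed
  qed auto
  ultimately show ?thesis unfolding meager_in_def by blast
qed

theorem corollary6p21:
  shows "(\<forall>X\<in>infinite_tt_closure. minimal_subshift X \<and> uniquely_ergodic X \<longrightarrow>
            meager_in infinite_tt_closure_topology (orbit_equivalence_class X)) \<and>
         (\<forall>X\<in>infinite_tt_closure.
            \<not> residual_in infinite_tt_closure_topology (orbit_equivalence_class X))"
proof (intro conjI ballI impI)
  fix X assume X: "X \<in> infinite_tt_closure"
  show "meager_in infinite_tt_closure_topology (orbit_equivalence_class X)"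
    using X by (rule meager_orbit_equivalence_class)
  show "\<not> residual_in infinite_tt_closure_topology (orbit_equivalence_class X)"
    using completely_metrizable_infinite_tt_closure _ meager_orbit_equivalence_class[OF X]
    by (rule meager_not_residual) (use X in auto)
qed

end
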